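(* For every $\epsilon > 0$ there exists $n_0(\epsilon)$ such that for all $n \geq n_0(\epsilon)$ the following holds. If $G$ is a graph on $n$ vertices that is $\epsilon$-far from every disjoint union of cliques, then the least eigenvalue of its adjacency matrix satisfies $$\lambda_n(G) \leq -n^{1/4 - \epsilon}.$$
   Context: Graphs are finite, simple and undirected. The adjacency matrix $A_G$ of a graph $G$ on vertex set $V=\{1,\dots,n\}$ is the symmetric $0/1$ matrix with $(A_G)_{ij}=1$ iff $ij$ is an edge; its eigenvalues are $\lambda_1\ge\dots\ge\lambda_n$. Two graphs $G$ and $H$ on $n$ vertices are $\epsilon$-close if starting from $G$ one can obtain a graph isomorphic to $H$ by adding or removing at most $\epsilon n^2$ edges; otherwise they are $\epsilon$-far. "$\epsilon$-far from every disjoint union of cliques" means $\epsilon$-far from every graph on $n$ vertices each of whose connected components is a complete graph. *)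

theory Defs
  imports "Jordan_Normal_Form.Spectral_Radius"
begin

text \<open>A graph on \<open>n\<close> vertices has vertex set \<open>{0..<n}\<close>, so that vertices index the rows and
  columns of its adjacency matrix, and is given by its set of edges.\<close>

definition simple_graph :: "nat \<Rightarrow> nat set set \<Rightarrow> bool" where
  "simple_graph n E \<longleftrightarrow> (\<forall>e\<in>E. e \<subseteq> {0..<n} \<and> card e = 2)"

definition adjacency_matrix :: "nat \<Rightarrow> nat set set \<Rightarrow> real mat" where
  "adjacency_matrix n E = mat n n (\<lambda>(i, j). if {i, j} \<in> E then 1 else 0)"

text \<open>The adjacency matrix is real symmetric, so all its eigenvalues are real; for \<open>n > 0\<close> the set
  below is finite and nonempty. For \<open>n = 0\<close> the value is unspecified.\<close>

definition least_eigenvalue :: "nat \<Rightarrow> nat set set \<Rightarrow> real" where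
  "least_eigenvalue n E = Min (spectrum (adjacency_matrix n E))"

definition graph_isomorphic :: "nat \<Rightarrow> nat set set \<Rightarrow> nat set set \<Rightarrow> bool" where
  "graph_isomorphic n E F \<longleftrightarrow>
     (\<exists>f. bij_betw f {0..<n} {0..<n} \<and>
          (\<forall>u\<in>{0..<n}. \<forall>v\<in>{0..<n}. {u, v} \<in> E \<longleftrightarrow> {f u, f v} \<in> F))"

definition eps_close :: "real \<Rightarrow> nat \<Rightarrow> nat set set \<Rightarrow> nat set set \<Rightarrow> bool" where
  "eps_close \<epsilon> n G H \<longleftrightarrow>
     (\<exists>H'. simple_graph n H' \<and> graph_isomorphic n H' H \<and>
           real (card (sym_diff G H')) \<le> \<epsilon> * (real n)\<^sup>2)"

abbreviation eps_far :: "real \<Rightarrow> nat \<Rightarrow> nat set set \<Rightarrow> nat set set \<Rightarrow> bool" where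
  "eps_far \<epsilon> n G H \<equiv> \<not> eps_close \<epsilon> n G H"

definition connected_components :: "nat \<Rightarrow> nat set set \<Rightarrow> nat set set" where
  "connected_components n E =
     {0..<n} // ({(u, v). {u, v} \<in> E}\<^sup>* \<inter> {0..<n} \<times> {0..<n})"

definition disjoint_union_of_cliques :: "nat \<Rightarrow> nat set set \<Rightarrow> bool" where
  "disjoint_union_of_cliques n E \<longleftrightarrow> simple_graph n E \<and>
     (\<forall>C \<in> connected_components n E. \<forall>u\<in>C. \<forall>v\<in>C. u \<noteq> v \<longrightarrow> {u, v} \<in> E)"

end

theory Submission
  imports Defs "HOL-Analysis.Function_Topology" "HOL-Analysis.Summation_Tests" "HOL-Analysis.Convex"
begin

text \<open>Let \<open>A\<close> be the adjacency matrix, \<open>-\<lambda>\<close> its least eigenvalue, and \<open>S r\<close> the sum of the \<open>r\<close>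
  largest eigenvalues (negative ones counted as \<open>0\<close>). If \<open>B\<close> is the spectral truncation of \<open>A\<close> to
  these eigenvalues, then \<open>0 \<le> B \<le> A + \<lambda>I\<close>, so the Schur product theorem bounds the entrywise
  square of \<open>B\<close> by the entrywise square of \<open>A + \<lambda>I\<close>, which is \<open>A + \<lambda>\<^sup>2I\<close> because \<open>A\<close> is a zero-one
  matrix with zero diagonal. The entrywise square of \<open>B\<close> has rank at most \<open>r\<^sup>2\<close>; taking traces gives
  \<open>(S r)\<^sup>2 / n \<le> S (r\<^sup>2) + \<lambda>\<^sup>2r\<^sup>2\<close>. Since \<open>S r \<le> \<lambda>n\<close> always, iterated squaring shows for
  \<open>\<lambda> \<le> n powr (\<beta>/2)\<close> that \<open>S r < 2 n r powr \<beta>\<close> for every \<open>r \<ge> 2\<close>. With \<open>\<beta> = 1/2 - 2\<epsilon>\<close> the squared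
  eigenvalues are then summable uniformly in \<open>n\<close>, so \<open>A\<close> is approximated in Frobenius norm by a
  matrix of bounded rank, hence by a block matrix with boundedly many blocks. A test vector
  supported on three large blocks excludes block patterns of induced cherries (paths on three
  vertices), so \<open>G\<close> has few induced cherries, and greedy clustering turns it into a disjoint union of
  cliques.\<close>

section \<open>Orthonormal families in coordinates\<close>

text \<open>Vectors are functions on \<open>nat\<close> of which only the values below
  \<open>n\<close> enter; a family of \<open>m\<close> vectors is likewise a function of which only
  the members below \<open>m\<close> matter.\<close>

definition dotn :: "nat \<Rightarrow> (nat \<Rightarrow> real) \<Rightarrow> (nat \<Rightarrow> real) \<Rightarrow> real" where
  "dotn n x y = (\<Sum>i<n. x i * y i)"

definition apply_mat :: "nat \<Rightarrow> (nat \<Rightarrow> nat \<Rightarrow> real) \<Rightarrow> (nat \<Rightarrow> real) \<Rightarrow> nat \<Rightarrow> real" where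
  "apply_mat n A x i = (\<Sum>j<n. A i j * x j)"

definition orthonormal :: "nat \<Rightarrow> nat \<Rightarrow> (nat \<Rightarrow> nat \<Rightarrow> real) \<Rightarrow> bool" where
  "orthonormal n m q \<longleftrightarrow> (\<forall>a<m. \<forall>b<m. dotn n (q a) (q b) = (if a = b then 1 else 0))"

text \<open>For orthonormal \<open>q\<close> this is the component of \<open>x\<close> orthogonal to
  the span of the first \<open>m\<close> members.\<close>

definition residual :: "nat \<Rightarrow> nat \<Rightarrow> (nat \<Rightarrow> nat \<Rightarrow> real) \<Rightarrow> (nat \<Rightarrow> real) \<Rightarrow> nat \<Rightarrow> real" where
  "residual n m q x i = x i - (\<Sum>a<m. dotn n x (q a) * q a i)"

lemma dotn_commute: "dotn n x y = dotn n y x"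
  by (simp add: dotn_def mult.commute)

lemma dotn_cong:
  "(\<And>i. i < n \<Longrightarrow> x i = x' i) \<Longrightarrow> (\<And>i. i < n \<Longrightarrow> y i = y' i) \<Longrightarrow> dotn n x y = dotn n x' y'"
  by (simp add: dotn_def)

lemma dotn_scale_left: "dotn n (\<lambda>i. c * x i) y = c * dotn n x y"
  by (simp add: dotn_def sum_distrib_left mult.assoc)

lemma dotn_add_left: "dotn n (\<lambda>i. x i + y i) z = dotn n x z + dotn n y z"
  by (simp add: dotn_def sum.distrib algebra_simps)

lemma dotn_diff_left: "dotn n (\<lambda>i. x i - y i) z = dotn n x z - dotn n y z"
  by (simp add: dotn_def sum_subtractf algebra_simps)

lemma dotn_scale_right: "dotn n x (\<lambda>i. c * y i) = c * dotn n x y"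
  by (simp add: dotn_def sum_distrib_left mult_ac)

lemma dotn_add_right: "dotn n x (\<lambda>i. y i + z i) = dotn n x y + dotn n x z"
  by (simp add: dotn_def sum.distrib algebra_simps)

lemma dotn_diff_right: "dotn n x (\<lambda>i. y i - z i) = dotn n x y - dotn n x z"
  by (simp add: dotn_def sum_subtractf algebra_simps)

lemma dotn_sum_left: "dotn n (\<lambda>i. \<Sum>a\<in>S. f a i) z = (\<Sum>a\<in>S. dotn n (f a) z)"
  unfolding dotn_def sum_distrib_right by (rule sum.swap)

lemma dotn_self_nonneg: "0 \<le> dotn n x x"
  by (simp add: dotn_def sum_nonneg)

lemma dotn_self_eq_0: "dotn n x x = 0 \<longleftrightarrow> (\<forall>i<n. x i = 0)"
  by (auto simp: dotn_def sum_nonneg_eq_0_iff)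

lemma apply_mat_symmetric:
  assumes "\<And>i j. i < n \<Longrightarrow> j < n \<Longrightarrow> A i j = A j i"
  shows "dotn n (apply_mat n A x) y = dotn n x (apply_mat n A y)"
proof -
  have "dotn n (apply_mat n A x) y = (\<Sum>i<n. \<Sum>j<n. A i j * x j * y i)"
    by (simp add: dotn_def apply_mat_def sum_distrib_right)
  also have "\<dots> = (\<Sum>j<n. \<Sum>i<n. A i j * x j * y i)"
    by (rule sum.swap)
  also have "\<dots> = (\<Sum>j<n. \<Sum>i<n. x j * (A j i * y i))"
    using assms by (intro sum.cong) (auto simp: mult_ac)
  also have "\<dots> = dotn n x (apply_mat n A y)"
    by (simp add: dotn_def apply_mat_def sum_distrib_left)
  finally show ?thesis .
qed

lemma apply_mat_scale: "apply_mat n A (\<lambda>i. c * x i) = (\<lambda>i. c * apply_mat n A x i)"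
  by (rule ext) (simp add: apply_mat_def sum_distrib_left mult_ac)

lemma apply_mat_add: "apply_mat n A (\<lambda>i. x i + y i) = (\<lambda>i. apply_mat n A x i + apply_mat n A y i)"
  by (rule ext) (simp add: apply_mat_def sum.distrib algebra_simps)

lemma dotn_residual:
  assumes "orthonormal n m q" "b < m"
  shows "dotn n (residual n m q x) (q b) = 0"
proof -
  have "dotn n (residual n m q x) (q b) = dotn n x (q b) - (\<Sum>a<m. dotn n x (q a) * dotn n (q a) (q b))"
    unfolding residual_def dotn_diff_left dotn_sum_left dotn_scale_left ..
  also have "(\<Sum>a<m. dotn n x (q a) * dotn n (q a) (q b)) = (\<Sum>a<m. if a = b then dotn n x (q a) else 0)"
    using assms by (intro sum.cong) (auto simp: orthonormal_def)
  finally show ?thesis using assms by simp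
qed

lemma dotn_residual_left:
  "dotn n x (residual n m q x) = dotn n x x - (\<Sum>a<m. (dotn n x (q a))\<^sup>2)"
proof -
  have "dotn n x (residual n m q x) = dotn n (\<lambda>i. x i - (\<Sum>a<m. dotn n x (q a) * q a i)) x"
    by (subst dotn_commute) (simp add: residual_def cong: dotn_cong)
  also have "\<dots> = dotn n x x - (\<Sum>a<m. dotn n x (q a) * dotn n (q a) x)"
    unfolding dotn_diff_left dotn_sum_left dotn_scale_left ..
  finally show ?thesis
    by (simp add: dotn_commute[of n "q a" x for a] power2_eq_square)
qed

lemma dotn_residual_self:
  assumes "orthonormal n m q"
  shows "dotn n (residual n m q x) (residual n m q x) = dotn n x x - (\<Sum>a<m. (dotn n x (q a))\<^sup>2)"
proof -
  let ?w = "residual n m q x"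
  have "dotn n ?w ?w = dotn n (\<lambda>i. x i - (\<Sum>a<m. dotn n x (q a) * q a i)) ?w"
    by (simp add: residual_def cong: dotn_cong)
  also have "\<dots> = dotn n x ?w - (\<Sum>a<m. dotn n x (q a) * dotn n (q a) ?w)"
    unfolding dotn_diff_left dotn_sum_left dotn_scale_left ..
  also have "(\<Sum>a<m. dotn n x (q a) * dotn n (q a) ?w) = 0"
    by (intro sum.neutral) (simp add: dotn_commute[of n _ ?w] dotn_residual[OF assms])
  finally show ?thesis by (simp add: dotn_residual_left)
qed

lemma bessel:
  assumes "orthonormal n m q"
  shows "(\<Sum>a<m. (dotn n x (q a))\<^sup>2) \<le> dotn n x x"
  using dotn_residual_self[OF assms, of x] dotn_self_nonneg[of n "residual n m q x"] by simp

lemma dotn_indicator: "i < n \<Longrightarrow> dotn n (\<lambda>k. if k = i then 1 else 0) x = x i"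
  by (simp add: dotn_def if_distrib[of "\<lambda>c. c * _"] cong: if_cong)

lemma orthonormal_coordinate_le:
  assumes "orthonormal n m q" "i < n"
  shows "(\<Sum>a<m. (q a i)\<^sup>2) \<le> 1"
  using bessel[OF assms(1), of "\<lambda>k. if k = i then 1 else 0"] dotn_indicator[OF assms(2)]
  by simp

text \<open>Double counting: the squared entries sum to 1 along each vector of the family.\<close>

lemma orthonormal_sum_coordinates:
  assumes "orthonormal n m q"
  shows "(\<Sum>i<n. \<Sum>a<m. (q a i)\<^sup>2) = real m"
proof -
  have "(\<Sum>i<n. \<Sum>a<m. (q a i)\<^sup>2) = (\<Sum>a<m. \<Sum>i<n. (q a i)\<^sup>2)" by (rule sum.swap)
  also have "\<dots> = (\<Sum>a<m. 1)"
    using assms by (intro sum.cong) (auto simp: orthonormal_def dotn_def power2_eq_square)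
  finally show ?thesis by simp
qed

section \<open>The spectral theorem for real symmetric matrices\<close>

lemma exists_unit_orthogonal:
  assumes "orthonormal n m q" "m < n"
  shows "\<exists>x. (\<forall>i\<ge>n. x i = 0) \<and> dotn n x x = 1 \<and> (\<forall>a<m. dotn n x (q a) = 0)"
proof -
  \<comment> \<open>All squared entries of the family sum to \<open>m < n\<close>, so some
    coordinate has mass below 1. The standard basis vector there lies outside the span, and its
    residual can be normalised.\<close>
  have "\<exists>i<n. (\<Sum>a<m. (q a i)\<^sup>2) < 1"
  proof (rule ccontr)
    assume "\<not> ?thesis"
    then have "(\<Sum>i<n. \<Sum>a<m. (q a i)\<^sup>2) \<ge> (\<Sum>i<n. 1)"
      by (intro sum_mono) (meson lessThan_iff not_less)
    then show False using orthonormal_sum_coordinates[OF assms(1)] assms(2) by simp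
  qed
  then obtain i where i: "i < n" "(\<Sum>a<m. (q a i)\<^sup>2) < 1" by blast
  define w where "w = residual n m q (\<lambda>k. if k = i then 1 else 0)"
  have ww: "dotn n w w > 0"
    unfolding w_def dotn_residual_self[OF assms(1)] using i by (simp add: dotn_indicator)
  define x where "x = (\<lambda>k. if k < n then (1 / sqrt (dotn n w w)) * w k else 0)"
  have x: "dotn n x y = (1 / sqrt (dotn n w w)) * dotn n w y" for y
    unfolding dotn_scale_left[symmetric] by (rule dotn_cong) (auto simp: x_def)
  have "dotn n x x = 1"
    using ww by (simp add: x dotn_commute[of n w x])
  moreover have "dotn n x (q a) = 0" if "a < m" for a
    by (simp add: x w_def dotn_residual[OF assms(1) that])
  moreover have "x k = 0" if "k \<ge> n" for k using that by (simp add: x_def)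
  ultimately show ?thesis by blast
qed

text \<open>Pinning the coordinates from \<open>n\<close> on to 0 places the set in a product of
  compact sets, compact by Tychonoff; the set is closed because continuous equations cut it
  out.\<close>

lemma compact_unit_orthogonal:
  "compact {x :: nat \<Rightarrow> real. (\<forall>i\<ge>n. x i = 0) \<and> dotn n x x = 1 \<and> (\<forall>a<m. dotn n x (q a) = 0)}"
  (is "compact ?W")
proof -
  define K :: "(nat \<Rightarrow> real) set" where "K = PiE UNIV (\<lambda>i. if i < n then {-1..1} else {0})"
  have "compactin (product_topology (\<lambda>i. euclidean) UNIV) K"
    unfolding K_def by (subst compactin_PiE) auto
  then have K: "compact K" by (simp add: euclidean_product_topology)
  have "?W \<subseteq> K"
  proof
    fix x assume x: "x \<in> ?W"
    have "\<bar>x i\<bar> \<le> 1" if "i < n" for i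
    proof -
      have "(x i)\<^sup>2 \<le> dotn n x x"
        unfolding dotn_def power2_eq_square using that by (intro member_le_sum) auto
      then show ?thesis using x by (simp add: abs_square_le_1)
    qed
    then show "x \<in> K" using x by (force simp: K_def PiE_def abs_le_iff)
  qed
  moreover have "closed ?W"
  proof -
    have *: "continuous_on UNIV (\<lambda>x::nat \<Rightarrow> real. x i)" for i by simp
    have "?W = (\<Inter>i\<in>{n..}. {x. x i = 0}) \<inter> {x. dotn n x x = 1} \<inter> (\<Inter>a\<in>{..<m}. {x. dotn n x (q a) = 0})"
      by auto
    moreover have "closed \<dots>"
      unfolding dotn_def
      by (intro closed_Int closed_INT ballI closed_Collect_eq continuous_intros *)
    ultimately show ?thesis by simp
  qed
  ultimately show ?thesis using K compact_Int_closed[of K ?W] by (simp add: Int_absorb1)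
qed

text \<open>Rayleigh quotient: the form attains its maximum over unit vectors orthogonal to the
  earlier eigenvectors, and a maximiser is an eigenvector. The last conclusion is kept because the
  ordering of the eigenvalues rests on it.\<close>

lemma exists_max_eigenvector:
  assumes sym: "\<And>i j. i < n \<Longrightarrow> j < n \<Longrightarrow> A i j = A j i"
    and on: "orthonormal n m v" and mn: "m < n"
    and eig: "\<And>a i. a < m \<Longrightarrow> i < n \<Longrightarrow> apply_mat n A (v a) i = l a * v a i"
  obtains x c where "dotn n x x = 1" "\<And>a. a < m \<Longrightarrow> dotn n x (v a) = 0"
    "\<And>i. i < n \<Longrightarrow> apply_mat n A x i = c * x i"
    "\<And>z. (\<And>a. a < m \<Longrightarrow> dotn n z (v a) = 0) \<Longrightarrow> dotn n z (apply_mat n A z) \<le> c * dotn n z z"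
proof -
  let ?W = "{x :: nat \<Rightarrow> real. (\<forall>i\<ge>n. x i = 0) \<and> dotn n x x = 1 \<and> (\<forall>a<m. dotn n x (v a) = 0)}"
  let ?A = "apply_mat n A"
  have *: "continuous_on S (\<lambda>x::nat \<Rightarrow> real. x i)" for i S
    by (rule continuous_on_subset[OF continuous_on_product_coordinates]) simp
  have cont: "continuous_on ?W (\<lambda>x. dotn n x (?A x))"
    unfolding dotn_def apply_mat_def by (intro continuous_intros *)
  obtain x where x: "x \<in> ?W" and max: "\<And>y. y \<in> ?W \<Longrightarrow> dotn n y (?A y) \<le> dotn n x (?A x)"
  proof -
    have "?W \<noteq> {}" using exists_unit_orthogonal[OF on mn] by blast
    from continuous_attains_sup[OF compact_unit_orthogonal this cont] that
    show thesis by (elim bexE) auto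
  qed
  define c where "c = dotn n x (?A x)"
  have le: "dotn n z (?A z) \<le> c * dotn n z z" if z: "\<And>a. a < m \<Longrightarrow> dotn n z (v a) = 0" for z
  proof (cases "dotn n z z = 0")
    case True
    then have "dotn n z (?A z) = 0" by (simp add: dotn_self_eq_0) (simp add: dotn_def)
    then show ?thesis using True by simp
  next
    case False
    then have pos: "dotn n z z > 0" using dotn_self_nonneg[of n z] by linarith
    \<comment> \<open>A nonzero \<open>z\<close> is rescaled to a unit vector with zero tail, which
      competes in \<open>?W\<close>. Both forms are quadratic, so the factor \<open>s * s\<close>
      cancels.\<close>
    define s where "s = 1 / sqrt (dotn n z z)"
    have s2: "s * s * dotn n z z = 1" using pos by (simp add: s_def)
    define y where "y = (\<lambda>k. if k < n then s * z k else 0)"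
    have y: "dotn n y w = s * dotn n z w" for w
      unfolding dotn_scale_left[symmetric] by (rule dotn_cong) (auto simp: y_def)
    have Ay: "?A y = (\<lambda>i. s * ?A z i)"
      unfolding apply_mat_scale[symmetric] by (rule ext) (simp add: apply_mat_def y_def)
    have "dotn n y y = 1" using s2 by (simp add: y dotn_commute[of n z y] mult.assoc)
    moreover have "\<forall>a<m. dotn n y (v a) = 0" using z by (simp add: y)
    ultimately have "y \<in> ?W" by (simp add: y_def)
    from max[OF this] have "s * s * dotn n z (?A z) \<le> c"
      unfolding Ay c_def[symmetric]
      by (simp add: y dotn_scale_right mult.assoc)
    then have "(s * s * dotn n z (?A z)) * dotn n z z \<le> c * dotn n z z"
      using pos by (intro mult_right_mono) auto
    moreover have "(s * s * dotn n z (?A z)) * dotn n z z = (s * s * dotn n z z) * dotn n z (?A z)"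
      by (simp add: mult_ac)
    ultimately show ?thesis using s2 by simp
  qed
  have x1: "dotn n x x = 1" and xv: "\<And>a. a < m \<Longrightarrow> dotn n x (v a) = 0" using x by auto
  \<comment> \<open>The defect in the eigenvector equation. Symmetry of \<open>A\<close> and the
    eigenvector equations of the \<open>v a\<close> make it orthogonal to them, so \<open>le\<close>
    applies to \<open>x + t y\<close> for every \<open>t\<close>.\<close>
  define y where "y = (\<lambda>i. ?A x i - c * x i)"
  have yv: "dotn n y (v a) = 0" if "a < m" for a
  proof -
    have "dotn n (?A x) (v a) = dotn n x (?A (v a))" by (rule apply_mat_symmetric[OF sym])
    also have "\<dots> = dotn n x (\<lambda>i. l a * v a i)" using eig[OF that] by (intro dotn_cong) auto
    also have "\<dots> = 0" using xv[OF that] by (simp add: dotn_scale_right)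
    finally show ?thesis using xv[OF that] by (simp add: y_def dotn_diff_left dotn_scale_left)
  qed
  \<comment> \<open>First-order optimality of \<open>x\<close> along the line \<open>x + t y\<close>.\<close>
  have yy: "dotn n y y = dotn n y (?A x) - c * dotn n y x"
    by (subst (2) y_def) (simp add: dotn_diff_right dotn_scale_right)
  define q where "q = c * dotn n y y - dotn n y (?A y)"
  have key: "2 * t * dotn n y y \<le> t\<^sup>2 * q" for t
  proof -
    let ?z = "\<lambda>i. x i + t * y i"
    have "dotn n ?z (v a) = 0" if "a < m" for a
      using xv[OF that] yv[OF that] by (simp add: dotn_add_left dotn_scale_left)
    from le[OF this] have 1: "dotn n ?z (?A ?z) \<le> c * dotn n ?z ?z" .
    have 2: "dotn n ?z ?z = 1 + 2 * t * dotn n y x + t\<^sup>2 * dotn n y y"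
      using x1 by (simp add: dotn_add_left dotn_scale_left dotn_add_right dotn_scale_right
          dotn_commute[of n x y] power2_eq_square algebra_simps)
    have 3: "dotn n x (?A y) = dotn n y (?A x)"
      using apply_mat_symmetric[where A = A and x = x and y = y, OF sym] dotn_commute by metis
    have "dotn n ?z (?A ?z) = dotn n ?z (\<lambda>i. ?A x i + t * ?A y i)"
      by (simp only: apply_mat_add apply_mat_scale)
    also have "\<dots> = c + 2 * t * dotn n y (?A x) + t\<^sup>2 * dotn n y (?A y)"
      using 3 by (simp add: dotn_add_left dotn_scale_left dotn_add_right dotn_scale_right c_def
          power2_eq_square algebra_simps)
    finally show ?thesis using 1 2 unfolding yy q_def by (simp add: algebra_simps)
  qed
  have "dotn n y y = 0"
  proof (rule ccontr)
    assume "dotn n y y \<noteq> 0"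
    then have pos: "dotn n y y > 0" using dotn_self_nonneg[of n y] by linarith
    \<comment> \<open>This \<open>t\<close> keeps \<open>t * q\<close> at most
      \<open>dotn n y y\<close>, whereas \<open>key\<close> forces it to be at least twice that. The
      summand 1 keeps the denominator positive.\<close>
    define t where "t = dotn n y y / (1 + \<bar>q\<bar>)"
    have t: "t > 0" "t * (1 + \<bar>q\<bar>) = dotn n y y" using pos by (auto simp: t_def add_pos_nonneg)
    have "t * (2 * dotn n y y) \<le> t * (t * q)" using key[of t] by (simp add: power2_eq_square mult_ac)
    then have "2 * dotn n y y \<le> t * q" using t by (simp only: mult_le_cancel_left_pos)
    also have "\<dots> \<le> t * (1 + \<bar>q\<bar>)" using t by (intro mult_left_mono) auto
    finally show False using t pos by simp
  qed
  then have "?A x i = c * x i" if "i < n" for i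
    using that by (simp add: dotn_self_eq_0 y_def)
  with that[OF x1 xv _ le] show thesis by blast
qed

text \<open>Eigenvectors are split off one at a time. The last conjunct of the induction says that
  every earlier eigenvalue bounds the form on the remaining complement, which makes the next
  eigenvalue no larger.\<close>

lemma symmetric_eigenbasis:
  assumes sym: "\<And>i j. i < n \<Longrightarrow> j < n \<Longrightarrow> A i j = A j i"
  obtains v l where "orthonormal n n v"
    "\<And>a i. a < n \<Longrightarrow> i < n \<Longrightarrow> apply_mat n A (v a) i = l a * v a i"
    "\<And>a b. a \<le> b \<Longrightarrow> b < n \<Longrightarrow> l b \<le> l a"
proof -
  have "\<exists>v l. orthonormal n m v \<and>
      (\<forall>a<m. \<forall>i<n. apply_mat n A (v a) i = l a * v a i) \<and>
      (\<forall>b<m. \<forall>a\<le>b. l b \<le> l a) \<and>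
      (\<forall>a<m. \<forall>z. (\<forall>b<m. dotn n z (v b) = 0) \<longrightarrow> dotn n z (apply_mat n A z) \<le> l a * dotn n z z)"
    if "m \<le> n" for m
    using that
  proof (induction m)
    case 0
    show ?case by (simp add: orthonormal_def)
  next
    case (Suc m)
    then obtain v l where on: "orthonormal n m v"
      and eig: "\<And>a i. a < m \<Longrightarrow> i < n \<Longrightarrow> apply_mat n A (v a) i = l a * v a i"
      and dec: "\<And>a b. b < m \<Longrightarrow> a \<le> b \<Longrightarrow> l b \<le> l a"
      and max: "\<And>a z. a < m \<Longrightarrow> (\<And>b. b < m \<Longrightarrow> dotn n z (v b) = 0) \<Longrightarrow>
        dotn n z (apply_mat n A z) \<le> l a * dotn n z z"
      by (metis Suc_leD)
    obtain x c where x: "dotn n x x = 1" "\<And>a. a < m \<Longrightarrow> dotn n x (v a) = 0"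
        "\<And>i. i < n \<Longrightarrow> apply_mat n A x i = c * x i"
      and c: "\<And>z. (\<And>a. a < m \<Longrightarrow> dotn n z (v a) = 0) \<Longrightarrow>
        dotn n z (apply_mat n A z) \<le> c * dotn n z z"
      using exists_max_eigenvector[where A = A and v = v and l = l, OF sym on _ eig] Suc.prems
      by (metis Suc_le_lessD)
    have cl: "c \<le> l a" if "a < m" for a
    proof -
      have "dotn n x (apply_mat n A x) = dotn n x (\<lambda>i. c * x i)" by (rule dotn_cong) (auto simp: x)
      then have "dotn n x (apply_mat n A x) = c" by (simp add: dotn_scale_right x)
      then show ?thesis using max[OF that x(2)] x(1) by simp
    qed
    let ?v = "v(m := x)" and ?l = "l(m := c)"
    have "orthonormal n (Suc m) ?v"
      using on x by (auto simp: orthonormal_def less_Suc_eq dotn_commute[of n "v a" x for a])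
    moreover have "\<forall>a<Suc m. \<forall>i<n. apply_mat n A (?v a) i = ?l a * ?v a i"
      using eig x(3) by (auto simp: less_Suc_eq)
    moreover have "\<forall>b<Suc m. \<forall>a\<le>b. ?l b \<le> ?l a"
      using dec cl by (auto simp: less_Suc_eq)
    moreover have "dotn n z (apply_mat n A z) \<le> ?l a * dotn n z z"
      if "a < Suc m" "\<forall>b<Suc m. dotn n z (?v b) = 0" for a z
    proof -
      have z: "dotn n z (v b) = 0" if "b < m" for b
        using \<open>\<forall>b<Suc m. dotn n z (?v b) = 0\<close>[rule_format, of b] that by simp
      show ?thesis
      proof (cases "a = m")
        case True then show ?thesis using c[OF z] by simp
      next
        case False then show ?thesis using max[OF _ z, of a] that(1) by simp
      qed
    qed
    ultimately show ?case by blast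
  qed
  from this[OF order_refl] that show thesis by metis
qed

text \<open>By Bessel the \<open>n\<close> coordinate masses are at most 1 each, and they sum to
  \<open>n\<close>, so all equal 1. Hence standard basis vectors have zero residual, which read at
  coordinate \<open>j\<close> is the claim.\<close>

lemma orthonormal_basis_complete:
  assumes on: "orthonormal n n v" and i: "i < n" and j: "j < n"
  shows "(\<Sum>a<n. v a i * v a j) = (if i = j then 1 else 0)"
proof -
  let ?e = "\<lambda>k. if k = i then 1 else (0::real)"
  have "(\<Sum>a<n. (v a i)\<^sup>2) = 1"
  proof (rule ccontr)
    assume "\<not> ?thesis"
    then have "(\<Sum>a<n. (v a i)\<^sup>2) < 1" using orthonormal_coordinate_le[OF on i] by simp
    then have "(\<Sum>i<n. \<Sum>a<n. (v a i)\<^sup>2) < (\<Sum>i<n. 1)"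
      using i orthonormal_coordinate_le[OF on] by (intro sum_strict_mono_ex1) auto
    then show False using orthonormal_sum_coordinates[OF on] by simp
  qed
  then have "dotn n (residual n n v ?e) (residual n n v ?e) = 0"
    using i by (simp add: dotn_residual_self[OF on] dotn_indicator)
  then have "residual n n v ?e j = 0" using j by (simp add: dotn_self_eq_0)
  then have "(if j = i then 1 else 0) = (\<Sum>a<n. v a i * v a j)"
    using i by (simp add: residual_def dotn_indicator)
  then show ?thesis by (metis (no_types, lifting))
qed

lemma parseval:
  assumes on: "orthonormal n n v"
  shows "(\<Sum>a<n. (dotn n x (v a))\<^sup>2) = dotn n x x"
proof -
  have "(\<Sum>a<n. (dotn n x (v a))\<^sup>2) = (\<Sum>a<n. \<Sum>i<n. \<Sum>j<n. x i * x j * (v a i * v a j))"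
    by (simp add: dotn_def power2_eq_square sum_product mult_ac)
  also have "\<dots> = (\<Sum>i<n. \<Sum>j<n. \<Sum>a<n. x i * x j * (v a i * v a j))"
    by (rule trans[OF sum.swap], rule sum.cong[OF refl], rule sum.swap)
  also have "\<dots> = (\<Sum>i<n. \<Sum>j<n. x i * x j * (if i = j then 1 else 0))"
    using orthonormal_basis_complete[OF on] by (intro sum.cong refl) (simp flip: sum_distrib_left)
  also have "\<dots> = dotn n x x"
    by (simp add: dotn_def if_distrib[of "\<lambda>c. _ * c"] cong: if_cong)
  finally show ?thesis .
qed

text \<open>\<open>A\<close> is applied to the resolution of the identity given by
  \<open>orthonormal_basis_complete\<close>.\<close>

lemma spectral_expansion:
  assumes on: "orthonormal n n v"
    and eig: "\<And>a i. a < n \<Longrightarrow> i < n \<Longrightarrow> apply_mat n A (v a) i = l a * v a i"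
    and i: "i < n" and j: "j < n"
  shows "A i j = (\<Sum>a<n. l a * v a i * v a j)"
proof -
  have "(\<Sum>a<n. l a * v a i * v a j) = (\<Sum>a<n. \<Sum>k<n. A i k * (v a k * v a j))"
    using eig[OF _ i, symmetric]
    by (intro sum.cong refl) (simp add: apply_mat_def sum_distrib_right mult.assoc)
  also have "\<dots> = (\<Sum>k<n. A i k * (\<Sum>a<n. v a k * v a j))"
    by (subst sum.swap) (simp add: sum_distrib_left)
  also have "\<dots> = (\<Sum>k<n. A i k * (if k = j then 1 else 0))"
    using orthonormal_basis_complete[OF on _ j] by (intro sum.cong refl) auto
  also have "\<dots> = A i j" using j by (simp add: if_distrib[of "\<lambda>c. _ * c"] cong: if_cong)
  finally show ?thesis ..
qed

text \<open>Equality in Bessel's inequality expresses that \<open>w\<close> lies in the span of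
  \<open>q\<close>. The bound on \<open>m\<close> later serves as a rank bound.\<close>

lemma gram_schmidt_family:
  assumes "finite F"
  shows "\<exists>m q. m \<le> card F \<and> orthonormal n m q \<and>
    (\<forall>w\<in>F. (\<Sum>a<m. (dotn n w (q a))\<^sup>2) = dotn n w w)"
  using assms
proof (induction F)
  case empty
  show ?case by (intro exI[of _ 0]) (simp add: orthonormal_def)
next
  case (insert w F)
  then obtain m q where m: "m \<le> card F" and on: "orthonormal n m q"
    and F: "\<And>w. w \<in> F \<Longrightarrow> (\<Sum>a<m. (dotn n w (q a))\<^sup>2) = dotn n w w" by blast
  define d where "d = residual n m q w"
  have dd: "dotn n d d = dotn n w w - (\<Sum>a<m. (dotn n w (q a))\<^sup>2)"
    by (simp add: d_def dotn_residual_self[OF on])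
  show ?case
  proof (cases "dotn n d d = 0")
    case True
    with dd F m insert.hyps show ?thesis
      by (intro exI[of _ m] exI[of _ q]) (auto simp: on)
  next
    case False
    then have pos: "dotn n d d > 0" using dotn_self_nonneg[of n d] by linarith
    define s where "s = 1 / sqrt (dotn n d d)"
    have s2: "s * s * dotn n d d = 1" using pos by (simp add: s_def)
    define q' where "q' = q(m := (\<lambda>i. s * d i))"
    have dq: "dotn n d (q a) = 0" if "a < m" for a
      unfolding d_def using on that by (rule dotn_residual)
    have on': "orthonormal n (Suc m) q'"
      using on dq s2
      by (auto simp: orthonormal_def q'_def less_Suc_eq dotn_scale_left dotn_scale_right mult.assoc
          dotn_commute[of n "q a" d for a])
    have q': "(\<Sum>a<m. (dotn n x (q' a))\<^sup>2) = (\<Sum>a<m. (dotn n x (q a))\<^sup>2)" for x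
      by (simp add: q'_def)
    have "(\<Sum>a<Suc m. (dotn n x (q' a))\<^sup>2) = dotn n x x" if "x \<in> insert w F" for x
    proof (cases "x = w")
      case True
      have "dotn n w (q' m) = s * dotn n d d"
        unfolding dd by (simp add: q'_def dotn_scale_right d_def dotn_residual_left)
      then have "(dotn n w (q' m))\<^sup>2 = (s * s * dotn n d d) * dotn n d d"
        by (simp add: power2_eq_square mult_ac)
      then show ?thesis using True dd s2 by (simp add: q')
    next
      case False
      \<comment> \<open>An additional vector only increases the Bessel sum, so earlier equalities
        persist once Bessel bounds the new sum from above.\<close>
      then have "dotn n x x \<le> (\<Sum>a<Suc m. (dotn n x (q' a))\<^sup>2)"
        using that F by (simp add: q')
      with bessel[OF on', of x] show ?thesis by simp
    qed
    then show ?thesis using on' m insert.hyps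
      by (intro exI[of _ "Suc m"] exI[of _ q']) auto
  qed
qed

section \<open>Quadratic forms of entrywise squares, and a rearrangement inequality\<close>

lemma sum_swap4:
  "(\<Sum>i\<in>I. \<Sum>j\<in>J. \<Sum>k\<in>K. \<Sum>l\<in>L. f i j k l) = (\<Sum>k\<in>K. \<Sum>l\<in>L. \<Sum>i\<in>I. \<Sum>j\<in>J. f i j k l)"
proof -
  have "(\<Sum>i\<in>I. \<Sum>j\<in>J. \<Sum>k\<in>K. \<Sum>l\<in>L. f i j k l) = (\<Sum>i\<in>I. \<Sum>k\<in>K. \<Sum>l\<in>L. \<Sum>j\<in>J. f i j k l)"
    by (intro sum.cong refl, subst sum.swap, intro sum.cong refl, rule sum.swap)
  also have "\<dots> = (\<Sum>k\<in>K. \<Sum>l\<in>L. \<Sum>i\<in>I. \<Sum>j\<in>J. f i j k l)"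
    by (subst sum.swap, intro sum.cong refl, rule sum.swap)
  finally show ?thesis .
qed

text \<open>The entrywise square of a spectral sum is the sum of rank-one matrices built from the
  products \<open>v k i * v l i\<close>, with weights \<open>m k * m l\<close>. For nonnegative
  \<open>m\<close> its form therefore grows with \<open>m\<close>, which is how the Schur product
  theorem enters.\<close>

lemma hadamard_square_form:
  fixes q :: "nat \<Rightarrow> real"
  shows "(\<Sum>i<n. \<Sum>j<n. q i * q j * (\<Sum>k<N. m k * v k i * v k j)\<^sup>2) =
    (\<Sum>k<N. \<Sum>l<N. m k * m l * (\<Sum>i<n. q i * v k i * v l i)\<^sup>2)"
proof -
  have "(\<Sum>i<n. \<Sum>j<n. q i * q j * (\<Sum>k<N. m k * v k i * v k j)\<^sup>2) =
      (\<Sum>i<n. \<Sum>j<n. \<Sum>k<N. \<Sum>l<N. q i * q j * ((m k * v k i * v k j) * (m l * v l i * v l j)))"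
    unfolding power2_eq_square sum_product by (simp only: sum_distrib_left)
  also have "\<dots> = (\<Sum>k<N. \<Sum>l<N. \<Sum>i<n. \<Sum>j<n. q i * q j * ((m k * v k i * v k j) * (m l * v l i * v l j)))"
    by (rule sum_swap4)
  also have "\<dots> = (\<Sum>k<N. \<Sum>l<N. m k * m l * (\<Sum>i<n. q i * v k i * v l i)\<^sup>2)"
    unfolding power2_eq_square sum_product
    by (intro sum.cong refl, simp only: sum_distrib_left, intro sum.cong refl) (simp add: mult_ac)
  finally show ?thesis .
qed

text \<open>Weights in the unit interval of total at most \<open>m\<close> do best on the
  \<open>m\<close> largest values. Nonnegativity of \<open>p\<close> handles a total strictly below
  \<open>m\<close>.\<close>

lemma weighted_sum_le_top:
  fixes p t :: "nat \<Rightarrow> real"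
  assumes dec: "\<And>a b. a \<le> b \<Longrightarrow> p b \<le> p a" and nonneg: "\<And>a. 0 \<le> p a"
    and t: "\<And>a. a < n \<Longrightarrow> 0 \<le> t a" "\<And>a. a < n \<Longrightarrow> t a \<le> 1" "(\<Sum>a<n. t a) \<le> real m"
  shows "(\<Sum>a<n. p a * t a) \<le> (\<Sum>a<m. p a)"
proof -
  define t' where "t' = (\<lambda>a. if a < n then t a else 0)"
  define h where "h = (\<lambda>a. if a < m then 1 else (0::real))"
  let ?N = "max n m"
  \<comment> \<open>The threshold \<open>p m\<close> separates the indices: \<open>p a - p m\<close>
    and \<open>t' a - h a\<close> never have the same strict sign.\<close>
  have "p a * t' a - p a * h a \<le> p m * (t' a - h a)" for a
  proof (cases "a < m")
    case True
    then have "t' a - h a \<le> 0" using t by (simp add: t'_def h_def)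
    moreover have "p m \<le> p a" using True dec by simp
    ultimately have "p a * (t' a - h a) \<le> p m * (t' a - h a)" by (rule mult_right_mono_neg[rotated])
    then show ?thesis by (simp add: algebra_simps)
  next
    case False
    then have "p a * t' a \<le> p m * t' a" using t dec[of m a] by (intro mult_right_mono) (auto simp: t'_def)
    then show ?thesis using False by (simp add: h_def)
  qed
  then have "(\<Sum>a<?N. p a * t' a - p a * h a) \<le> (\<Sum>a<?N. p m * (t' a - h a))" by (intro sum_mono)
  also have "\<dots> = p m * ((\<Sum>a<?N. t' a) - (\<Sum>a<?N. h a))"
    by (simp add: sum_distrib_left sum_subtractf right_diff_distrib)
  also have "(\<Sum>a<?N. t' a) = (\<Sum>a<n. t a)"
    by (rule sum.mono_neutral_cong_right) (auto simp: t'_def)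
  also have "(\<Sum>a<?N. h a) = (\<Sum>a<m. 1)"
    by (rule sum.mono_neutral_cong_right) (auto simp: h_def)
  also have "p m * ((\<Sum>a<n. t a) - (\<Sum>a<m. 1)) \<le> 0"
    using t nonneg[of m] by (intro mult_nonneg_nonpos) auto
  finally have "(\<Sum>a<?N. p a * t' a) \<le> (\<Sum>a<?N. p a * h a)" by (simp add: sum_subtractf)
  also have "(\<Sum>a<?N. p a * h a) = (\<Sum>a<m. p a)"
    by (rule sum.mono_neutral_cong_right) (auto simp: h_def)
  also have "(\<Sum>a<?N. p a * t' a) = (\<Sum>a<n. p a * t a)"
    by (rule sum.mono_neutral_cong_right) (auto simp: t'_def)
  finally show ?thesis .
qed

section \<open>Spectral mass of zero-one matrices\<close>

text \<open>Spectral data of a zero-one matrix with zero diagonal; \<open>lam\<close> is any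
  nonnegative number whose negative bounds the spectrum from below, so it need not be
  attained.\<close>

locale zero_one_spectrum =
  fixes n :: nat and A v :: "nat \<Rightarrow> nat \<Rightarrow> real" and l :: "nat \<Rightarrow> real" and lam :: real
  assumes on: "orthonormal n n v"
    and expansion: "\<And>i j. i < n \<Longrightarrow> j < n \<Longrightarrow> A i j = (\<Sum>k<n. l k * v k i * v k j)"
    and decreasing: "\<And>a b. a \<le> b \<Longrightarrow> b < n \<Longrightarrow> l b \<le> l a"
    and zero_one: "\<And>i j. i < n \<Longrightarrow> j < n \<Longrightarrow> A i j = 0 \<or> A i j = 1"
    and diagonal: "\<And>i. i < n \<Longrightarrow> A i i = 0"
    and lower: "\<And>k. k < n \<Longrightarrow> - lam \<le> l k"
    and lam_nonneg: "0 \<le> lam"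
begin

text \<open>Extending by 0 from \<open>n\<close> on keeps the sequence decreasing and lets
  \<open>top_sum\<close> be taken at \<open>r\<^sup>2\<close> even when that exceeds
  \<open>n\<close>.\<close>

definition eig_pos :: "nat \<Rightarrow> real" where
  "eig_pos k = (if k < n then max 0 (l k) else 0)"

definition top_sum :: "nat \<Rightarrow> real" where
  "top_sum r = (\<Sum>k<r. eig_pos k)"

lemma eig_pos_nonneg: "0 \<le> eig_pos k"
  by (simp add: eig_pos_def)

lemma eig_pos_decreasing: "a \<le> b \<Longrightarrow> eig_pos b \<le> eig_pos a"
  using decreasing[of a b] by (auto simp: eig_pos_def)

lemma eig_pos_le: "k < n \<Longrightarrow> eig_pos k \<le> l k + lam"
  using lower[of k] lam_nonneg by (simp add: eig_pos_def)

lemma top_sum_mono: "r \<le> s \<Longrightarrow> top_sum r \<le> top_sum s"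
  unfolding top_sum_def by (intro sum_mono2) (auto simp: eig_pos_nonneg)

lemma eigenvector_unit: "k < n \<Longrightarrow> (\<Sum>i<n. (v k i)\<^sup>2) = 1"
  using on by (simp add: orthonormal_def dotn_def power2_eq_square)

text \<open>The trace of \<open>A\<close> is 0, so the shifted eigenvalues \<open>l k + lam\<close>,
  which dominate \<open>eig_pos k\<close>, sum to \<open>lam * n\<close>.\<close>

lemma top_sum_le: "top_sum r \<le> lam * real n"
proof -
  have "(\<Sum>k<n. l k) = (\<Sum>k<n. \<Sum>i<n. l k * (v k i)\<^sup>2)"
    by (simp add: eigenvector_unit flip: sum_distrib_left)
  also have "\<dots> = (\<Sum>i<n. A i i)"
    by (subst sum.swap) (simp add: expansion power2_eq_square mult.assoc)
  finally have trace: "(\<Sum>k<n. l k) = 0" by (simp add: diagonal)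
  have "top_sum r \<le> top_sum (max r n)" by (rule top_sum_mono) simp
  also have "\<dots> = (\<Sum>k<n. eig_pos k)"
    unfolding top_sum_def by (rule sum.mono_neutral_right) (auto simp: eig_pos_def)
  also have "\<dots> \<le> (\<Sum>k<n. l k + lam)" by (intro sum_mono eig_pos_le) simp
  finally show ?thesis using trace by (simp add: sum.distrib mult.commute)
qed

lemma quadratic_form: "dotn n x (apply_mat n A x) = (\<Sum>k<n. l k * (dotn n x (v k))\<^sup>2)"
proof -
  have "dotn n x (apply_mat n A x) = (\<Sum>i<n. \<Sum>j<n. \<Sum>k<n. l k * ((x i * v k i) * (x j * v k j)))"
    by (simp add: dotn_def apply_mat_def expansion sum_distrib_left sum_distrib_right mult_ac)
  also have "\<dots> = (\<Sum>i<n. \<Sum>k<n. \<Sum>j<n. l k * ((x i * v k i) * (x j * v k j)))"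
    by (rule sum.cong[OF refl], rule sum.swap)
  also have "\<dots> = (\<Sum>k<n. \<Sum>i<n. \<Sum>j<n. l k * ((x i * v k i) * (x j * v k j)))"
    by (rule sum.swap)
  also have "\<dots> = (\<Sum>k<n. l k * (dotn n x (v k))\<^sup>2)"
    unfolding dotn_def power2_eq_square sum_product by (simp only: sum_distrib_left)
  finally show ?thesis .
qed

lemma quadratic_form_lower: "- lam * dotn n x x \<le> dotn n x (apply_mat n A x)"
proof -
  have "- lam * dotn n x x = (\<Sum>k<n. - lam * (dotn n x (v k))\<^sup>2)"
    by (simp only: parseval[OF on, symmetric] sum_distrib_left)
  also have "\<dots> \<le> (\<Sum>k<n. l k * (dotn n x (v k))\<^sup>2)"
    by (intro sum_mono mult_right_mono lower) auto
  finally show ?thesis by (simp add: quadratic_form)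
qed

text \<open>Ky Fan's maximum principle. The weight \<open>t k\<close> that the span of
  \<open>q\<close> puts on \<open>v k\<close> is at most 1 by Bessel, and the weights total
  \<open>m\<close> by Parseval.\<close>

lemma ky_fan:
  assumes q: "orthonormal n m q"
  shows "(\<Sum>a<m. dotn n (q a) (apply_mat n A (q a))) \<le> top_sum m"
proof -
  define t where "t = (\<lambda>k. \<Sum>a<m. (dotn n (q a) (v k))\<^sup>2)"
  have "(\<Sum>a<m. dotn n (q a) (apply_mat n A (q a))) = (\<Sum>k<n. l k * t k)"
    unfolding quadratic_form t_def sum_distrib_left by (rule sum.swap)
  also have "\<dots> \<le> (\<Sum>k<n. eig_pos k * t k)"
    by (intro sum_mono mult_right_mono) (auto simp: eig_pos_def t_def sum_nonneg)
  also have "\<dots> \<le> top_sum m"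
    unfolding top_sum_def
  proof (rule weighted_sum_le_top[OF eig_pos_decreasing eig_pos_nonneg])
    show "0 \<le> t k" for k by (simp add: t_def sum_nonneg)
    show "t k \<le> 1" if "k < n" for k
      using bessel[OF q, of "v k"] that on by (simp add: t_def orthonormal_def dotn_commute[of n "v k" "q a" for a])
    have "(\<Sum>k<n. t k) = (\<Sum>a<m. dotn n (q a) (q a))"
      unfolding t_def parseval[OF on, symmetric] by (rule sum.swap)
    then show "(\<Sum>k<n. t k) \<le> real m" using q by (simp add: orthonormal_def)
  qed
  finally show ?thesis .
qed

text \<open>The Schur product theorem, together with the fact that \<open>A\<close> is idempotent under the
  entrywise product.\<close>

lemma hadamard_square_le:
  "(\<Sum>k<min r n. \<Sum>k'<min r n. eig_pos k * eig_pos k' * (\<Sum>i<n. q i * v k i * v k' i)\<^sup>2)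
    \<le> dotn n q (apply_mat n A q) + lam\<^sup>2 * dotn n q q"
proof -
  let ?c = "\<lambda>k k'. (\<Sum>i<n. q i * v k i * v k' i)\<^sup>2"
  let ?m = "\<lambda>k. l k + lam"
  have "(\<Sum>k<min r n. \<Sum>k'<min r n. eig_pos k * eig_pos k' * ?c k k') \<le> (\<Sum>k<n. \<Sum>k'<min r n. eig_pos k * eig_pos k' * ?c k k')"
    by (intro sum_mono2) (auto intro!: sum_nonneg simp: eig_pos_nonneg)
  also have "\<dots> \<le> (\<Sum>k<n. \<Sum>k'<n. eig_pos k * eig_pos k' * ?c k k')"
    by (intro sum_mono sum_mono2) (auto simp: eig_pos_nonneg)
  also have "\<dots> \<le> (\<Sum>k<n. \<Sum>k'<n. ?m k * ?m k' * ?c k k')"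
  proof (intro sum_mono mult_right_mono)
    fix k k' assume "k \<in> {..<n}" "k' \<in> {..<n}"
    then show "eig_pos k * eig_pos k' \<le> ?m k * ?m k'"
      using eig_pos_le eig_pos_nonneg lower by (intro mult_mono) (auto simp: add.commute minus_le_iff intro: order_trans)
  qed simp
  \<comment> \<open>The \<open>?m k\<close> are the eigenvalues of \<open>A + lam I\<close>, so the
    inner sum becomes an entry of that matrix.\<close>
  also have "\<dots> = (\<Sum>i<n. \<Sum>j<n. q i * q j * (\<Sum>k<n. ?m k * v k i * v k j)\<^sup>2)"
    by (rule hadamard_square_form[symmetric])
  also have "\<dots> = (\<Sum>i<n. \<Sum>j<n. q i * (A i j * q j) + (if i = j then lam\<^sup>2 * (q i * q j) else 0))"
  proof (intro sum.cong refl)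
    fix i j assume "i \<in> {..<n}" "j \<in> {..<n}"
    then have i: "i < n" and j: "j < n" by auto
    have "(\<Sum>k<n. ?m k * v k i * v k j) = A i j + lam * (\<Sum>k<n. v k i * v k j)"
      by (simp add: expansion[OF i j] algebra_simps sum.distrib sum_distrib_left)
    then have "(\<Sum>k<n. ?m k * v k i * v k j) = A i j + (if i = j then lam else 0)"
      using orthonormal_basis_complete[OF on i j] by simp
    then show "q i * q j * (\<Sum>k<n. ?m k * v k i * v k j)\<^sup>2 =
        q i * (A i j * q j) + (if i = j then lam\<^sup>2 * (q i * q j) else 0)"
      using zero_one[OF i j] diagonal[OF i] by (auto simp: power2_eq_square)
  qed
  also have "\<dots> = dotn n q (apply_mat n A q) + lam\<^sup>2 * dotn n q q"
    by (simp add: sum.distrib dotn_def apply_mat_def sum_distrib_left)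
  finally show ?thesis .
qed

text \<open>With \<open>B\<close> the truncated matrix, Cauchy-Schwarz on its diagonal
  \<open>b\<close> bounds the squared trace of \<open>B\<close> by \<open>n\<close> times the trace
  of its entrywise square. That trace is computed inside a space of dimension at most
  \<open>r\<^sup>2\<close>, where \<open>hadamard_square_le\<close> and \<open>ky_fan\<close>
  apply.\<close>

lemma top_sum_square:
  "(top_sum r)\<^sup>2 \<le> real n * (top_sum (r\<^sup>2) + lam\<^sup>2 * (real r)\<^sup>2)"
proof -
  \<comment> \<open>Only indices below \<open>n\<close> carry genuine eigenvectors;
    \<open>eig_pos\<close> vanishes beyond, so nothing of \<open>top_sum r\<close> is lost.\<close>
  let ?K = "{..<min r n}"
  define b where "b = (\<lambda>i. \<Sum>k\<in>?K. eig_pos k * (v k i)\<^sup>2)"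
  have "(\<Sum>i<n. b i) = (\<Sum>k\<in>?K. eig_pos k * (\<Sum>i<n. (v k i)\<^sup>2))"
    unfolding b_def sum_distrib_left by (rule sum.swap)
  also have "\<dots> = (\<Sum>k\<in>?K. eig_pos k)" by (intro sum.cong) (auto simp: eigenvector_unit)
  also have "\<dots> = top_sum r"
    unfolding top_sum_def by (rule sum.mono_neutral_left) (auto simp: eig_pos_def)
  finally have trace: "top_sum r = (\<Sum>i<n. b i)" ..
  \<comment> \<open>The entrywise square of \<open>B\<close> is the sum of \<open>w w^T\<close> over
    these at most \<open>r\<^sup>2\<close> vectors, so an orthonormal family spanning them captures
    its whole trace.\<close>
  define w where "w = (\<lambda>(k, k') i. sqrt (eig_pos k) * sqrt (eig_pos k') * v k i * v k' i)"
  define F where "F = w ` (?K \<times> ?K)"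
  have "card F \<le> card (?K \<times> ?K)" unfolding F_def by (intro card_image_le) auto
  also have "\<dots> \<le> r * r" by (simp add: card_cartesian_product mult_mono)
  finally have F: "finite F" "card F \<le> r * r" by (auto simp: F_def)
  obtain m q where m: "m \<le> card F" and q: "orthonormal n m q"
    and span: "\<And>x. x \<in> F \<Longrightarrow> (\<Sum>a<m. (dotn n x (q a))\<^sup>2) = dotn n x x"
    using gram_schmidt_family[OF F(1)] by blast
  have m2: "m \<le> r\<^sup>2" using m F(2) by (simp add: power2_eq_square)
  have "(\<Sum>i<n. (b i)\<^sup>2) = (\<Sum>i<n. \<Sum>k\<in>?K. \<Sum>k'\<in>?K. w (k, k') i * w (k, k') i)"
    unfolding b_def power2_eq_square[of "sum _ _"] sum_product
  proof (intro sum.cong refl)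
    fix i k k'
    have "eig_pos k = sqrt (eig_pos k) * sqrt (eig_pos k)" "eig_pos k' = sqrt (eig_pos k') * sqrt (eig_pos k')" by (simp_all add: eig_pos_nonneg)
    then show "eig_pos k * (v k i)\<^sup>2 * (eig_pos k' * (v k' i)\<^sup>2) = w (k, k') i * w (k, k') i"
      by (simp add: w_def power2_eq_square mult_ac)
  qed
  also have "\<dots> = (\<Sum>k\<in>?K. \<Sum>k'\<in>?K. dotn n (w (k, k')) (w (k, k')))"
    unfolding dotn_def by (rule trans[OF sum.swap], rule sum.cong[OF refl], rule sum.swap)
  also have "\<dots> = (\<Sum>k\<in>?K. \<Sum>k'\<in>?K. \<Sum>a<m. (dotn n (w (k, k')) (q a))\<^sup>2)"
    by (intro sum.cong refl span[symmetric]) (auto simp: F_def)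
  also have "\<dots> = (\<Sum>k\<in>?K. \<Sum>a<m. \<Sum>k'\<in>?K. (dotn n (w (k, k')) (q a))\<^sup>2)"
    by (rule sum.cong[OF refl], rule sum.swap)
  also have "\<dots> = (\<Sum>a<m. \<Sum>k\<in>?K. \<Sum>k'\<in>?K. (dotn n (w (k, k')) (q a))\<^sup>2)"
    by (rule sum.swap)
  also have "\<dots> = (\<Sum>a<m. \<Sum>k\<in>?K. \<Sum>k'\<in>?K. eig_pos k * eig_pos k' * (\<Sum>i<n. q a i * v k i * v k' i)\<^sup>2)"
  proof (intro sum.cong refl)
    fix a k k'
    have "dotn n (w (k, k')) (q a) = sqrt (eig_pos k) * sqrt (eig_pos k') * (\<Sum>i<n. q a i * v k i * v k' i)"
      by (simp add: dotn_def w_def sum_distrib_left mult_ac)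
    then show "(dotn n (w (k, k')) (q a))\<^sup>2 = eig_pos k * eig_pos k' * (\<Sum>i<n. q a i * v k i * v k' i)\<^sup>2"
      by (simp add: power_mult_distrib eig_pos_nonneg)
  qed
  also have "\<dots> \<le> (\<Sum>a<m. dotn n (q a) (apply_mat n A (q a)) + lam\<^sup>2 * dotn n (q a) (q a))"
    by (intro sum_mono hadamard_square_le)
  also have "\<dots> = (\<Sum>a<m. dotn n (q a) (apply_mat n A (q a))) + lam\<^sup>2 * real m"
    using q by (simp add: sum.distrib orthonormal_def mult.commute)
  also have "\<dots> \<le> top_sum m + lam\<^sup>2 * real m"
    using ky_fan[OF q] by simp
  also have "\<dots> \<le> top_sum (r\<^sup>2) + lam\<^sup>2 * (real r)\<^sup>2"
    using m2 of_nat_mono[OF m2, where 'a = real]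
    by (intro add_mono top_sum_mono mult_left_mono) auto
  finally have "(\<Sum>i<n. (b i)\<^sup>2) \<le> top_sum (r\<^sup>2) + lam\<^sup>2 * (real r)\<^sup>2" .
  moreover have "(\<Sum>i<n. b i)\<^sup>2 \<le> real n * (\<Sum>i<n. (b i)\<^sup>2)"
    using Cauchy_Schwarz_ineq_sum[of b "\<lambda>_. 1" "{..<n}"] by (simp add: mult.commute)
  ultimately show ?thesis unfolding trace
    by (meson mult_left_mono of_nat_0_le_iff order_trans)
qed

text \<open>A violation at \<open>r\<close> propagates to \<open>r\<^sup>2\<close>. With
  \<open>x = r powr \<beta>\<close>, \<open>top_sum_le\<close> gives \<open>x \<le> lam\<close>,
  hence \<open>lam\<^sup>2 * r\<^sup>2 \<le> n * x\<^sup>2\<close>. Then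
  \<open>top_sum_square\<close> leaves at least \<open>3 * n * x\<^sup>2\<close> for
  \<open>top_sum (r\<^sup>2)\<close>, more than the \<open>2 * n * x\<^sup>2\<close>
  required.\<close>

lemma top_sum_growth:
  assumes n: "n > 0" and beta: "0 < \<beta>" "\<beta> \<le> 1" and lam: "lam \<le> real n powr (\<beta> / 2)" and r: "r \<ge> 1"
    and big: "2 * real r powr \<beta> * real n \<le> top_sum r"
  shows "2 * real (r\<^sup>2) powr \<beta> * real n \<le> top_sum (r\<^sup>2)"
proof -
  define x where "x = real r powr \<beta>"
  have x: "x > 0" using r by (simp add: x_def)
  have "2 * x * real n \<le> lam * real n" using big top_sum_le[of r] by (simp add: x_def)
  then have xl: "x \<le> lam" using n x by (simp add: mult_le_cancel_right)
  then have lp: "lam > 0" using x by linarith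
  \<comment> \<open>The exponent \<open>(2 - 2 * \<beta>) / \<beta>\<close> is nonnegative because
    \<open>\<beta> \<le> 1\<close>; together with the factor \<open>lam powr 2\<close> it adds up to
    exactly \<open>2 / \<beta>\<close>, which turns the bound on \<open>lam\<close> into
    \<open>n\<close>.\<close>
  have "real r powr (2 - 2 * \<beta>) = x powr ((2 - 2 * \<beta>) / \<beta>)"
    using beta r by (simp add: x_def powr_powr)
  also have "\<dots> \<le> lam powr ((2 - 2 * \<beta>) / \<beta>)"
    using beta x xl by (intro powr_mono2) auto
  finally have "lam powr 2 * real r powr (2 - 2 * \<beta>) \<le> lam powr 2 * lam powr ((2 - 2 * \<beta>) / \<beta>)"
    by (intro mult_left_mono) auto
  also have "\<dots> = lam powr (2 / \<beta>)"
    using beta by (simp add: diff_divide_distrib flip: powr_add)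
  also have "\<dots> \<le> (real n powr (\<beta> / 2)) powr (2 / \<beta>)"
    using beta lp lam by (intro powr_mono2) auto
  also have "\<dots> = real n" using beta n by (simp add: powr_powr)
  finally have *: "lam\<^sup>2 * real r powr (2 - 2 * \<beta>) \<le> real n"
    using lp by (simp add: powr_numeral)
  have r2: "(real r)\<^sup>2 = real r powr (2 - 2 * \<beta>) * x\<^sup>2"
  proof -
    have "x\<^sup>2 = real r powr (2 * \<beta>)" using r by (simp add: x_def power2_eq_square flip: powr_add)
    then show ?thesis using r by (simp flip: powr_add add: powr_numeral)
  qed
  define X where "X = real n * x\<^sup>2"
  have "lam\<^sup>2 * (real r)\<^sup>2 \<le> X"
    unfolding r2 X_def mult.assoc[symmetric] using * by (intro mult_right_mono) auto
  moreover have "4 * X \<le> top_sum (r\<^sup>2) + lam\<^sup>2 * (real r)\<^sup>2"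
  proof -
    have "(2 * x * real n)\<^sup>2 \<le> real n * (top_sum (r\<^sup>2) + lam\<^sup>2 * (real r)\<^sup>2)"
      using big x by (intro order_trans[OF power_mono top_sum_square]) (auto simp: x_def)
    then have "real n * (4 * X) \<le> real n * (top_sum (r\<^sup>2) + lam\<^sup>2 * (real r)\<^sup>2)"
      by (simp add: X_def power2_eq_square mult_ac)
    then show ?thesis using n by (simp add: mult_le_cancel_left)
  qed
  moreover have "0 \<le> X" by (simp add: X_def)
  ultimately have "2 * X \<le> top_sum (r\<^sup>2)" by linarith
  moreover have "real (r\<^sup>2) powr \<beta> = x\<^sup>2"
    using r by (simp add: x_def power2_eq_square powr_mult)
  ultimately show ?thesis by (simp add: X_def mult_ac)
qed

text \<open>The violating \<open>r\<close> form a set closed under squaring by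
  \<open>top_sum_growth\<close> and bounded through \<open>top_sum_le\<close>. Its maximum would be
  at least 2 and no smaller than its own square.\<close>

lemma top_sum_less:
  assumes n: "n > 0" and beta: "0 < \<beta>" "\<beta> \<le> 1" and lam: "lam \<le> real n powr (\<beta> / 2)" and r: "r \<ge> 2"
  shows "top_sum r < 2 * real r powr \<beta> * real n"
proof (rule ccontr)
  assume contra: "\<not> ?thesis"
  define R where "R = {r. r \<ge> 2 \<and> 2 * real r powr \<beta> * real n \<le> top_sum r}"
  have "s \<le> nat \<lfloor>lam powr (1 / \<beta>)\<rfloor>" if "s \<in> R" for s
  proof -
    have "2 * real s powr \<beta> * real n \<le> lam * real n"
      using that top_sum_le[of s] by (simp add: R_def)
    then have "2 * real s powr \<beta> \<le> lam" using n by (simp add: mult_le_cancel_right)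
    then have "real s powr \<beta> \<le> lam" by (smt (verit) powr_ge_zero)
    then have "(real s powr \<beta>) powr (1 / \<beta>) \<le> lam powr (1 / \<beta>)"
      using beta by (intro powr_mono2) auto
    then have "real s \<le> lam powr (1 / \<beta>)" using beta by (simp add: powr_powr)
    then show ?thesis by (simp add: le_nat_iff le_floor_iff)
  qed
  then have fin: "finite R" by (meson finite_nat_set_iff_bounded_le)
  have "r \<in> R" using r contra by (simp add: R_def)
  then have M: "Max R \<in> R" using fin Max_in by blast
  then have "(Max R)\<^sup>2 \<in> R"
    using top_sum_growth[OF n beta lam, of "Max R"] by (auto simp: R_def power2_eq_square intro: order_trans[OF _ le_square])
  then have "(Max R)\<^sup>2 \<le> Max R" using fin by simp
  then show False using M by (simp add: R_def power2_eq_square)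
qed

end

section \<open>Approximation in Frobenius norm by matrices of bounded rank\<close>

context zero_one_spectrum
begin

lemma frobenius_eq:
  "(\<Sum>i<n. \<Sum>j<n. (\<Sum>k<n. c k * v k i * v k j)\<^sup>2) = (\<Sum>k<n. (c k)\<^sup>2)"
proof -
  have "(\<Sum>i<n. \<Sum>j<n. (\<Sum>k<n. c k * v k i * v k j)\<^sup>2) =
      (\<Sum>k<n. \<Sum>k'<n. c k * c k' * (dotn n (v k) (v k'))\<^sup>2)"
    using hadamard_square_form[where q = "\<lambda>_. 1" and m = c and v = v and N = n and n = n]
    by (simp add: dotn_def)
  also have "\<dots> = (\<Sum>k<n. \<Sum>k'<n. if k = k' then (c k)\<^sup>2 else 0)"
    using on by (intro sum.cong refl) (auto simp: orthonormal_def power2_eq_square)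
  finally show ?thesis by simp
qed

text \<open>The eigenvalue of index \<open>k\<close> is at most the average of the first
  \<open>Suc k\<close>; \<open>k \<ge> 1\<close> supplies the two terms that
  \<open>top_sum_less\<close> asks for.\<close>

lemma eig_pos_bound:
  assumes n: "n > 0" and beta: "0 < \<beta>" "\<beta> \<le> 1" and lam: "lam \<le> real n powr (\<beta> / 2)" and k: "k \<ge> 1"
  shows "eig_pos k \<le> 2 * real n * real (Suc k) powr (\<beta> - 1)"
proof -
  have "real (Suc k) * eig_pos k = (\<Sum>j<Suc k. eig_pos k)" by simp
  also have "\<dots> \<le> top_sum (Suc k)" unfolding top_sum_def by (intro sum_mono eig_pos_decreasing) auto
  also have "\<dots> \<le> 2 * real (Suc k) powr \<beta> * real n"
    using top_sum_less[OF n beta lam, of "Suc k"] k by simp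
  also have "real (Suc k) powr \<beta> = real (Suc k) * real (Suc k) powr (\<beta> - 1)"
    by (simp add: powr_mult_base)
  finally have "real (Suc k) * eig_pos k \<le> real (Suc k) * (2 * real n * real (Suc k) powr (\<beta> - 1))"
    by (simp only: mult_ac)
  then show ?thesis by (simp only: mult_le_cancel_left_pos of_nat_0_less_iff zero_less_Suc)
qed

text \<open>The error splits into the squared positive eigenvalues from index \<open>r\<close> on
  and the negative ones, at most \<open>n\<close> in number and each of square at most
  \<open>lam\<^sup>2\<close>. The square roots put the approximant into the form of a Gram matrix,
  so that rows can be rounded later.\<close>

lemma low_rank_error:
  assumes n: "n > 0" and beta: "0 < \<beta>" "\<beta> \<le> 1" and lam: "lam \<le> real n powr (\<beta> / 2)" and r: "r \<ge> 1"
  shows "(\<Sum>i<n. \<Sum>j<n. (A i j - (\<Sum>k<r. (sqrt (eig_pos k) * v k i) * (sqrt (eig_pos k) * v k j)))\<^sup>2)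
    \<le> 4 * (real n)\<^sup>2 * (\<Sum>k=r..<n. real (Suc k) powr (2 * \<beta> - 2)) + real n * lam\<^sup>2"
proof -
  \<comment> \<open>The eigenvalues of the error matrix; below index \<open>r\<close> only the
    negative part of \<open>l k\<close> remains.\<close>
  define c where "c = (\<lambda>k. l k - (if k < r then eig_pos k else 0))"
  have "A i j - (\<Sum>k<r. (sqrt (eig_pos k) * v k i) * (sqrt (eig_pos k) * v k j)) = (\<Sum>k<n. c k * v k i * v k j)"
    if "i < n" "j < n" for i j
  proof -
    have "(\<Sum>k<r. (sqrt (eig_pos k) * v k i) * (sqrt (eig_pos k) * v k j)) = (\<Sum>k<r. eig_pos k * (v k i * v k j))"
      by (intro sum.cong refl) (metis (no_types, lifting) mult.assoc mult.left_commute eig_pos_nonneg real_sqrt_mult_self abs_of_nonneg)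
    also have "\<dots> = (\<Sum>k<max r n. (if k < r then eig_pos k else 0) * (v k i * v k j))"
      by (rule sum.mono_neutral_cong_left) auto
    also have "\<dots> = (\<Sum>k<n. (if k < r then eig_pos k else 0) * (v k i * v k j))"
      by (rule sum.mono_neutral_cong_right) (auto simp: eig_pos_def)
    finally show ?thesis
      by (simp add: expansion[OF that] c_def left_diff_distrib sum_subtractf mult.assoc)
  qed
  then have "(\<Sum>i<n. \<Sum>j<n. (A i j - (\<Sum>k<r. (sqrt (eig_pos k) * v k i) * (sqrt (eig_pos k) * v k j)))\<^sup>2)
      = (\<Sum>i<n. \<Sum>j<n. (\<Sum>k<n. c k * v k i * v k j)\<^sup>2)"
    by (intro sum.cong refl) simp
  also have "\<dots> = (\<Sum>k<n. (c k)\<^sup>2)" by (rule frobenius_eq)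
  also have "\<dots> \<le> (\<Sum>k<n. (if r \<le> k then (eig_pos k)\<^sup>2 else 0) + lam\<^sup>2)"
  proof (rule sum_mono)
    fix k assume "k \<in> {..<n}"
    then have k: "k < n" by simp
    show "(c k)\<^sup>2 \<le> (if r \<le> k then (eig_pos k)\<^sup>2 else 0) + lam\<^sup>2"
    proof (cases "l k \<ge> 0")
      case True
      then show ?thesis using k by (auto simp: c_def eig_pos_def)
    next
      case False
      then have "c k = l k" using k by (auto simp: c_def eig_pos_def)
      moreover have "(l k)\<^sup>2 \<le> lam\<^sup>2" using False lower[OF k] by (intro abs_le_square_iff[THEN iffD1]) auto
      ultimately show ?thesis by (auto intro: add_increasing)
    qed
  qed
  also have "\<dots> = (\<Sum>k=r..<n. (eig_pos k)\<^sup>2) + real n * lam\<^sup>2"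
  proof -
    have "(\<Sum>k<n. if r \<le> k then (eig_pos k)\<^sup>2 else 0) = (\<Sum>k=r..<n. (eig_pos k)\<^sup>2)"
      by (rule sum.mono_neutral_cong_right) auto
    then show ?thesis by (simp add: sum.distrib)
  qed
  also have "(\<Sum>k=r..<n. (eig_pos k)\<^sup>2) \<le> (\<Sum>k=r..<n. 4 * (real n)\<^sup>2 * real (Suc k) powr (2 * \<beta> - 2))"
  proof (rule sum_mono)
    fix k assume "k \<in> {r..<n}"
    then have "eig_pos k \<le> 2 * real n * real (Suc k) powr (\<beta> - 1)"
      using eig_pos_bound[OF n beta lam] r by auto
    then have "(eig_pos k)\<^sup>2 \<le> (2 * real n * real (Suc k) powr (\<beta> - 1))\<^sup>2"
      using eig_pos_nonneg by (intro power_mono) auto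
    also have "\<dots> = 4 * (real n)\<^sup>2 * (real (Suc k) powr (\<beta> - 1) * real (Suc k) powr (\<beta> - 1))"
      by (simp add: power2_eq_square)
    also have "real (Suc k) powr (\<beta> - 1) * real (Suc k) powr (\<beta> - 1) = real (Suc k) powr (2 * \<beta> - 2)"
      by (simp flip: powr_add)
    finally show "(eig_pos k)\<^sup>2 \<le> 4 * (real n)\<^sup>2 * real (Suc k) powr (2 * \<beta> - 2)" .
  qed
  finally show ?thesis by (simp add: sum_distrib_left)
qed

lemma scaled_eigenvector_norm:
  assumes n: "n > 0" and beta: "0 < \<beta>" "\<beta> \<le> 1" and lam: "lam \<le> real n powr (\<beta> / 2)"
  shows "(\<Sum>i<n. (sqrt (eig_pos k) * v k i)\<^sup>2) \<le> 4 * real n"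
proof (cases "k < n")
  case True
  have "(\<Sum>i<n. (sqrt (eig_pos k) * v k i)\<^sup>2) = eig_pos k"
    by (simp add: power_mult_distrib eig_pos_nonneg eigenvector_unit[OF True] flip: sum_distrib_left)
  also have "\<dots> \<le> eig_pos 0" by (rule eig_pos_decreasing) simp
  also have "\<dots> \<le> top_sum 2" using eig_pos_nonneg[of 1] by (simp add: top_sum_def numeral_2_eq_2)
  also have "\<dots> \<le> 2 * 2 powr \<beta> * real n" using top_sum_less[OF n beta lam, of 2] by simp
  also have "\<dots> \<le> 2 * 2 * real n"
    using beta powr_mono[of \<beta> 1 2] by (intro mult_right_mono mult_left_mono) auto
  finally show ?thesis by simp
next
  case False
  then show ?thesis by (simp add: eig_pos_def)
qed

end

text \<open>With \<open>\<beta> = 1 / 2 - 2 * \<epsilon>\<close> the exponent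
  \<open>2 * \<beta> - 2\<close> is below -1, so the tail of squared eigenvalues is small relative
  to \<open>n\<^sup>2\<close> at an index \<open>r\<close> independent of \<open>n\<close>. The
  negative eigenvalues contribute at most \<open>n * sqrt n\<close>.\<close>

lemma low_rank_approximation:
  assumes eps: "0 < \<epsilon>" "\<epsilon> < 1 / 4" and del: "\<delta> > 0"
  shows "\<exists>(r::nat) n\<^sub>0. \<forall>n\<ge>n\<^sub>0. \<forall>A v l lam. zero_one_spectrum n A v l lam \<longrightarrow>
    lam \<le> real n powr (1 / 4 - \<epsilon>) \<longrightarrow>
    (\<exists>u. (\<forall>k<r. (\<Sum>i<n. (u k i)\<^sup>2) \<le> 4 * real n) \<and>
      (\<Sum>i<n. \<Sum>j<n. (A i j - (\<Sum>k<r. u k i * u k j))\<^sup>2) \<le> \<delta> * (real n)\<^sup>2)"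
proof -
  define \<beta> where "\<beta> = 1 / 2 - 2 * \<epsilon>"
  have beta: "0 < \<beta>" "\<beta> \<le> 1" "2 * \<beta> - 2 < -1" "\<beta> / 2 = 1 / 4 - \<epsilon>" using eps by (auto simp: \<beta>_def)
  have "summable (\<lambda>k. real (Suc k) powr (2 * \<beta> - 2))"
    using beta(3) summable_Suc_iff[of "\<lambda>k. real k powr (2 * \<beta> - 2)"] by (simp add: summable_real_powr_iff)
  \<comment> \<open>The prefactor 4 turns a tail of \<open>\<delta> / 8\<close> into half of the
    error budget; the negative eigenvalues receive the other half through the choice of
    \<open>n\<^sub>0\<close>.\<close>
  then obtain r0 where r0: "\<And>m n. m \<ge> r0 \<Longrightarrow> norm (\<Sum>k=m..<n. real (Suc k) powr (2 * \<beta> - 2)) < \<delta> / 8"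
    using del unfolding summable_Cauchy by (metis divide_pos_pos zero_less_numeral)
  define r where "r = max r0 1"
  define n\<^sub>0 where "n\<^sub>0 = nat \<lceil>(2 / \<delta>)\<^sup>2\<rceil> + 1"
  show ?thesis
  proof (rule exI[of _ r], rule exI[of _ n\<^sub>0], intro allI impI)
    fix n A v l lam
    assume nn: "n \<ge> n\<^sub>0" and z: "zero_one_spectrum n A v l lam" and lam: "lam \<le> real n powr (1 / 4 - \<epsilon>)"
    interpret zero_one_spectrum n A v l lam by (rule z)
    have n: "n > 0" using nn by (simp add: n\<^sub>0_def)
    have lam': "lam \<le> real n powr (\<beta> / 2)" using lam by (simp only: beta(4))
    define u where "u = (\<lambda>k i. sqrt (eig_pos k) * v k i)"
    have "lam\<^sup>2 \<le> (real n powr (\<beta> / 2))\<^sup>2" using lam' lam_nonneg by (intro power_mono) auto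
    also have "\<dots> = real n powr \<beta>" by (simp add: power2_eq_square flip: powr_add)
    also have "\<dots> \<le> real n powr (1 / 2)" using n eps by (intro powr_mono) (auto simp: \<beta>_def)
    also have "\<dots> = sqrt (real n)" by (simp add: powr_half_sqrt)
    also have "\<dots> \<le> \<delta> / 2 * real n"
    proof -
      have "(2 / \<delta>)\<^sup>2 \<le> real n" using nn unfolding n\<^sub>0_def by linarith
      then have "2 / \<delta> \<le> sqrt (real n)" using del by (intro real_le_rsqrt) auto
      then have "1 \<le> \<delta> / 2 * sqrt (real n)" using del by (simp add: field_simps)
      then have "sqrt (real n) * 1 \<le> sqrt (real n) * (\<delta> / 2 * sqrt (real n))" by (intro mult_left_mono) auto
      then show ?thesis by (simp add: mult_ac)
    qed
    finally have "real n * lam\<^sup>2 \<le> real n * (\<delta> / 2 * real n)" by (intro mult_left_mono) auto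
    moreover have "4 * (real n)\<^sup>2 * (\<Sum>k=r..<n. real (Suc k) powr (2 * \<beta> - 2)) \<le> 4 * (real n)\<^sup>2 * (\<delta> / 8)"
    proof (intro mult_left_mono)
      have "norm (\<Sum>k=r..<n. real (Suc k) powr (2 * \<beta> - 2)) < \<delta> / 8" by (rule r0) (simp add: r_def)
      then show "(\<Sum>k=r..<n. real (Suc k) powr (2 * \<beta> - 2)) \<le> \<delta> / 8" by simp
    qed simp
    moreover have "(\<Sum>i<n. \<Sum>j<n. (A i j - (\<Sum>k<r. u k i * u k j))\<^sup>2)
        \<le> 4 * (real n)\<^sup>2 * (\<Sum>k=r..<n. real (Suc k) powr (2 * \<beta> - 2)) + real n * lam\<^sup>2"
      unfolding u_def using low_rank_error[OF n beta(1,2) lam', of r] by (simp add: r_def)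
    ultimately have "(\<Sum>i<n. \<Sum>j<n. (A i j - (\<Sum>k<r. u k i * u k j))\<^sup>2)
        \<le> 4 * (real n)\<^sup>2 * (\<delta> / 8) + real n * (\<delta> / 2 * real n)" by linarith
    also have "\<dots> = \<delta> * (real n)\<^sup>2" by (simp add: power2_eq_square)
    finally show "\<exists>u. (\<forall>k<r. (\<Sum>i<n. (u k i)\<^sup>2) \<le> 4 * real n) \<and>
      (\<Sum>i<n. \<Sum>j<n. (A i j - (\<Sum>k<r. u k i * u k j))\<^sup>2) \<le> \<delta> * (real n)\<^sup>2"
      using scaled_eigenvector_norm[OF n beta(1,2) lam'] by (intro exI[of _ u]) (simp add: u_def)
  qed
qed

section \<open>Counting induced cherries\<close>

text \<open>The centre is the second component. For symmetric irreflexive \<open>adj\<close> each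
  induced path on three vertices is counted twice, once per orientation.\<close>

definition cherries :: "('a \<Rightarrow> 'a \<Rightarrow> bool) \<Rightarrow> 'a set \<Rightarrow> ('a \<times> 'a \<times> 'a) set" where
  "cherries adj U = {(i, j, k). i \<in> U \<and> j \<in> U \<and> k \<in> U \<and> adj i j \<and> adj j k \<and> \<not> adj i k \<and> i \<noteq> k}"

definition block_mean :: "'a set \<Rightarrow> ('a \<Rightarrow> 'b) \<Rightarrow> ('a \<Rightarrow> real) \<Rightarrow> 'b \<Rightarrow> real" where
  "block_mean S g f y = (\<Sum>x | x \<in> S \<and> g x = y. f x) / real (card {x \<in> S. g x = y})"

text \<open>On each fibre of \<open>g\<close> the mean minimises the sum of squared deviations. Any
  block approximation may therefore be replaced by the one made of block densities.\<close>

lemma block_mean_minimizes: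
  assumes "finite S"
  shows "(\<Sum>x\<in>S. (f x - block_mean S g f (g x))\<^sup>2) \<le> (\<Sum>x\<in>S. (f x - b (g x))\<^sup>2)"
proof -
  have group: "(\<Sum>x\<in>S. h x (g x)) = (\<Sum>y\<in>g ` S. \<Sum>x | x \<in> S \<and> g x = y. h x y)"
    for h :: "'a \<Rightarrow> 'b \<Rightarrow> real"
  proof -
    have "(\<Sum>x\<in>S. h x (g x)) = (\<Sum>y\<in>g ` S. \<Sum>x | x \<in> S \<and> g x = y. h x (g x))"
      by (rule sum.group[OF assms finite_imageI[OF assms] subset_refl, symmetric])
    also have "\<dots> = (\<Sum>y\<in>g ` S. \<Sum>x | x \<in> S \<and> g x = y. h x y)"
      by (intro sum.cong) auto
    finally show ?thesis .
  qed
  have le: "(\<Sum>x | x \<in> S \<and> g x = y. (f x - block_mean S g f y)\<^sup>2) \<le> (\<Sum>x | x \<in> S \<and> g x = y. (f x - b y)\<^sup>2)" for y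
  proof (cases "card {x \<in> S. g x = y} = 0")
    case True
    then have "{x \<in> S. g x = y} = {}" using assms by simp
    then show ?thesis by (simp only: sum.empty)
  next
    case False
    let ?T = "{x \<in> S. g x = y}" and ?m = "block_mean S g f y"
    have m: "(\<Sum>x\<in>?T. f x) = real (card ?T) * ?m" using False by (simp add: block_mean_def)
    have "(\<Sum>x\<in>?T. (f x - b y)\<^sup>2) =
        (\<Sum>x\<in>?T. (f x - ?m)\<^sup>2 + ((2 * (?m - b y)) * f x + ((b y)\<^sup>2 - ?m\<^sup>2)))"
      by (intro sum.cong refl) (simp add: power2_eq_square algebra_simps)
    also have "\<dots> = (\<Sum>x\<in>?T. (f x - ?m)\<^sup>2) + (2 * (?m - b y) * (\<Sum>x\<in>?T. f x) + real (card ?T) * ((b y)\<^sup>2 - ?m\<^sup>2))"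
      by (simp add: sum.distrib flip: sum_distrib_left)
    also have "\<dots> = (\<Sum>x\<in>?T. (f x - ?m)\<^sup>2) + real (card ?T) * (?m - b y)\<^sup>2"
      unfolding m by (simp add: power2_eq_square algebra_simps)
    finally show ?thesis by simp
  qed
  show ?thesis
    unfolding group[of "\<lambda>x y. (f x - block_mean S g f y)\<^sup>2"] group[of "\<lambda>x y. (f x - b y)\<^sup>2"]
    by (rule sum_mono) (rule le)
qed

section \<open>Test vectors supported on blocks\<close>

lemma apply_mat_diff: "apply_mat n A (\<lambda>i. x i - y i) = (\<lambda>i. apply_mat n A x i - apply_mat n A y i)"
  by (rule ext) (simp add: apply_mat_def sum_subtractf algebra_simps)

lemma sum_if_member:
  fixes n :: nat
  assumes "P \<subseteq> {..<n}"
  shows "(\<Sum>i<n. (if i \<in> P then c else 0) * h i) = (c::real) * (\<Sum>i\<in>P. h i)"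
proof -
  have "(\<Sum>i<n. (if i \<in> P then c else 0) * h i) = (\<Sum>i\<in>P. c * h i)"
    using assms by (intro sum.mono_neutral_cong_right) auto
  then show ?thesis by (simp add: sum_distrib_left)
qed

text \<open>Were \<open>d 0 2\<close> small, the signed combination \<open>z\<close> of normalised
  block indicators would have form below \<open>3 - 18/5 + 1/5 = -2/5\<close> but squared norm at
  most \<open>9 / t\<close>, against the lower bound on the form. Blocks may coincide, as two
  vertices of a cherry can share a cell, so the norm bound avoids disjointness.\<close>

lemma no_cherry_of_blocks:
  fixes A :: "nat \<Rightarrow> nat \<Rightarrow> real" and P :: "nat \<Rightarrow> nat set"
  assumes sym: "\<And>i j. i < n \<Longrightarrow> j < n \<Longrightarrow> A i j = A j i"
    and le1: "\<And>i j. i < n \<Longrightarrow> j < n \<Longrightarrow> A i j \<le> 1"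
    and form: "\<And>x. - lam * dotn n x x \<le> dotn n x (apply_mat n A x)" and lam: "0 \<le> lam"
    and P: "\<And>a. P a \<subseteq> {..<n}" "\<And>a. t \<le> real (card (P a))" and t: "45 * lam < 2 * t"
    and d: "\<And>a b. d a b = (\<Sum>i\<in>P a. \<Sum>j\<in>P b. A i j) / (real (card (P a)) * real (card (P b)))"
    and d01: "d 0 1 > 9 / 10" and d12: "d 1 2 > 9 / 10"
  shows "d 0 2 \<ge> 1 / 10"
proof (rule ccontr)
  assume d02: "\<not> ?thesis"
  have tp: "t > 0" using t lam by linarith
  \<comment> \<open>Dividing by the block size turns values of the form into edge densities.\<close>
  define x where "x = (\<lambda>a i. if i \<in> P a then 1 / real (card (P a)) else 0)"
  have cp: "real (card (P a)) > 0" for a using P(2)[of a] tp by linarith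
  have xAx: "dotn n (x a) (apply_mat n A (x b)) = d a b" for a b
  proof -
    have "apply_mat n A (x b) i = (1 / real (card (P b))) * (\<Sum>j\<in>P b. A i j)" for i
      unfolding apply_mat_def x_def using sum_if_member[OF P(1)[of b], of "1 / real (card (P b))" "A i"]
      by (simp add: mult.commute)
    then have "dotn n (x a) (apply_mat n A (x b)) =
        (\<Sum>i<n. x a i * ((1 / real (card (P b))) * (\<Sum>j\<in>P b. A i j)))"
      by (simp add: dotn_def)
    also have "\<dots> = (1 / real (card (P a))) * (\<Sum>i\<in>P a. (1 / real (card (P b))) * (\<Sum>j\<in>P b. A i j))"
      unfolding x_def by (rule sum_if_member[OF P(1)])
    also have "\<dots> = d a b" by (simp add: d sum_divide_distrib[symmetric])
    finally show ?thesis .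
  qed
  have xx: "dotn n (x a) (x a) \<le> 1 / t" for a
  proof -
    have "dotn n (x a) (x a) = (1 / real (card (P a))) * (\<Sum>i\<in>P a. x a i)"
      unfolding dotn_def by (subst (1) x_def) (rule sum_if_member[OF P(1)])
    also have "(\<Sum>i\<in>P a. x a i) = 1" using cp[of a] by (simp add: x_def)
    finally show ?thesis using P(2)[of a] tp by (simp add: frac_le)
  qed
  have d_le: "d a a \<le> 1" for a
  proof -
    have "(\<Sum>i\<in>P a. \<Sum>j\<in>P a. A i j) \<le> (\<Sum>i\<in>P a. \<Sum>j\<in>P a. 1)"
      using P(1)[of a] by (intro sum_mono le1) auto
    then show ?thesis using cp[of a] by (simp add: d divide_le_eq)
  qed
  have d_sym: "d a b = d b a" for a b
    using apply_mat_symmetric[where A = A and n = n and x = "x a" and y = "x b", OF sym]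
    by (simp add: xAx dotn_commute[of n "apply_mat n A (x a)"])
  define z where "z = (\<lambda>i. x 0 i - x 1 i + x 2 i)"
  have "dotn n z (apply_mat n A z) = d 0 0 + d 1 1 + d 2 2 - 2 * d 0 1 - 2 * d 1 2 + 2 * d 0 2"
    unfolding z_def apply_mat_add apply_mat_diff
    using d_sym[of 1 0] d_sym[of 2 1] d_sym[of 2 0]
    by (simp add: dotn_add_left dotn_diff_left dotn_add_right dotn_diff_right xAx)
  also have "\<dots> < - (2 / 5)" using d_le[of 0] d_le[of 1] d_le[of 2] d01 d12 d02 by linarith
  finally have *: "dotn n z (apply_mat n A z) < - (2 / 5)" .
  have "dotn n z z \<le> dotn n (\<lambda>i. 3 * x 0 i) (x 0) + dotn n (\<lambda>i. 3 * x 1 i) (x 1) + dotn n (\<lambda>i. 3 * x 2 i) (x 2)"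
    unfolding dotn_def sum.distrib[symmetric]
  proof (rule sum_mono)
    fix i
    \<comment> \<open>These three squares are exactly the difference between the two sides of the
      goal.\<close>
    have "0 \<le> (x 0 i + x 1 i)\<^sup>2 + (x 1 i + x 2 i)\<^sup>2 + (x 0 i - x 2 i)\<^sup>2" by simp
    then show "z i * z i \<le> 3 * x 0 i * x 0 i + 3 * x 1 i * x 1 i + 3 * x 2 i * x 2 i"
      by (simp add: z_def power2_eq_square algebra_simps)
  qed
  also have "\<dots> \<le> 9 / t" unfolding dotn_scale_left using xx[of 0] xx[of 1] xx[of 2] by simp
  finally have "lam * dotn n z z \<le> lam * (9 / t)" using lam by (rule mult_left_mono)
  also have "\<dots> < 2 / 5" using t tp by (simp add: divide_less_eq)
  finally show False using form[of z] * by simp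
qed

text \<open>Every cherry meets \<open>X\<close>, meets a cell smaller than \<open>t\<close>, or
  contains a pair whose entry is far from its block density; otherwise its three cells contradict
  \<open>no_cherry_of_blocks\<close>. Each cause is counted in three positions.\<close>

lemma cherries_le_of_blocks:
  fixes A :: "nat \<Rightarrow> nat \<Rightarrow> real" and c :: "nat \<Rightarrow> 'b"
  assumes zero_one: "\<And>i j. i < n \<Longrightarrow> j < n \<Longrightarrow> A i j = 0 \<or> A i j = 1"
    and sym: "\<And>i j. i < n \<Longrightarrow> j < n \<Longrightarrow> A i j = A j i"
    and form: "\<And>x. - lam * dotn n x x \<le> dotn n x (apply_mat n A x)" and lam: "0 \<le> lam"
    and X: "X \<subseteq> {..<n}" and L: "finite L" "c ` ({..<n} - X) \<subseteq> L"
    and err: "(\<Sum>i\<in>{..<n} - X. \<Sum>j\<in>{..<n} - X. (A i j - b (c i) (c j))\<^sup>2) \<le> \<delta> * (real n)\<^sup>2"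
    and gap: "45 * lam < 2 * t"
  shows "real (card (cherries (\<lambda>i j. A i j = 1) {..<n}))
    \<le> 3 * (real (card X) + real (card L) * t) * (real n)\<^sup>2 + 300 * \<delta> * (real n) ^ 3"
proof -
  define V where "V = {..<n} - X"
  define cell where "cell a = {i \<in> V. c i = a}" for a
  have finV: "finite V" by (simp add: V_def)
  have fincell: "finite (cell a)" for a using finV by (simp add: cell_def)
  have tp: "t \<ge> 0" using gap lam by linarith
  let ?g = "\<lambda>(i, j). (c i, c j)" and ?f = "\<lambda>(i, j). A i j"
  \<comment> \<open>Block densities replace the given \<open>b\<close>, since the test vectors
    measure densities; \<open>block_mean_minimizes\<close> ensures that the error does not
    grow.\<close>
  define d where "d a b = block_mean (V \<times> V) ?g ?f (a, b)" for a b
  have blk: "{x. x \<in> V \<times> V \<and> ?g x = (a, b)} = cell a \<times> cell b" for a b by (auto simp: cell_def)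
  have d_eq: "d a b = (\<Sum>i\<in>cell a. \<Sum>j\<in>cell b. A i j) / (real (card (cell a)) * real (card (cell b)))" for a b
    unfolding d_def block_mean_def blk by (simp add: sum.cartesian_product card_cartesian_product)
  define Small where "Small = {i \<in> V. real (card (cell (c i))) < t}"
  define Y where "Y = X \<union> Small"
  define U where "U = {..<n}"
  have "Small \<subseteq> (\<Union>a\<in>{a \<in> L. real (card (cell a)) < t}. cell a)"
    using L(2) by (auto simp: Small_def cell_def V_def)
  then have "card Small \<le> card (\<Union>a\<in>{a \<in> L. real (card (cell a)) < t}. cell a)"
    using L(1) fincell by (intro card_mono) auto
  also have "\<dots> \<le> (\<Sum>a\<in>{a \<in> L. real (card (cell a)) < t}. card (cell a))"
    using L(1) by (intro card_UN_le) auto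
  finally have "real (card Small) \<le> (\<Sum>a\<in>{a \<in> L. real (card (cell a)) < t}. real (card (cell a)))"
    by (metis of_nat_le_iff of_nat_sum)
  also have "\<dots> \<le> (\<Sum>a\<in>{a \<in> L. real (card (cell a)) < t}. t)" by (intro sum_mono) auto
  also have "\<dots> \<le> (\<Sum>a\<in>L. t)" using L(1) tp by (intro sum_mono2) auto
  finally have Small: "real (card Small) \<le> real (card L) * t" by simp
  have Ysub: "Y \<subseteq> U" using X by (auto simp: Y_def Small_def V_def U_def)
  have cardY: "real (card Y) \<le> real (card X) + real (card L) * t"
    using Small of_nat_mono[OF card_Un_le[of X Small], where 'a = real] by (simp add: Y_def)
  \<comment> \<open>Chebyshev: pairs at distance at least 1/10 from their density. Outside
    \<open>M\<close>, edges have density above 9/10 and non-edges below 1/10.\<close>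
  define M where "M = {(i, j) \<in> V \<times> V. 1 / 100 \<le> (A i j - d (c i) (c j))\<^sup>2}"
  have Msub: "M \<subseteq> V \<times> V" by (auto simp: M_def)
  have "real (card M) / 100 = (\<Sum>(i, j)\<in>M. 1 / 100)" by simp
  also have "\<dots> \<le> (\<Sum>(i, j)\<in>M. (A i j - d (c i) (c j))\<^sup>2)" by (intro sum_mono) (auto simp: M_def)
  also have "\<dots> \<le> (\<Sum>(i, j)\<in>V \<times> V. (A i j - d (c i) (c j))\<^sup>2)"
    using finV Msub by (intro sum_mono2) auto
  also have "\<dots> = (\<Sum>x\<in>V \<times> V. (?f x - block_mean (V \<times> V) ?g ?f (?g x))\<^sup>2)"
    by (intro sum.cong refl) (auto simp: d_def)
  also have "\<dots> \<le> (\<Sum>x\<in>V \<times> V. (?f x - (\<lambda>(a, a'). b a a') (?g x))\<^sup>2)"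
    using finV by (intro block_mean_minimizes) auto
  also have "\<dots> = (\<Sum>i\<in>V. \<Sum>j\<in>V. (A i j - b (c i) (c j))\<^sup>2)"
    unfolding sum.cartesian_product by (intro sum.cong refl) auto
  finally have cardM: "real (card M) \<le> 100 * \<delta> * (real n)\<^sup>2" using err by (simp add: V_def)
  let ?C = "cherries (\<lambda>i j. A i j = 1) U"
  let ?T1 = "Y \<times> U \<times> U" and ?T2 = "U \<times> Y \<times> U" and ?T3 = "U \<times> U \<times> Y"
  \<comment> \<open>These maps insert the third vertex of the triple for each possible position of
    the bad pair.\<close>
  let ?h1 = "\<lambda>((i, j), k). (i, j, k)" and ?h2 = "\<lambda>((j, k), i). (i, j, k)" and ?h3 = "\<lambda>((i, k), j). (i, j, k)"
  let ?M = "M \<times> U"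
  have "?C \<subseteq> (?T1 \<union> ?T2 \<union> ?T3) \<union> (?h1 ` ?M \<union> ?h2 ` ?M \<union> ?h3 ` ?M)"
  proof
    fix z assume "z \<in> ?C"
    then obtain i j k where z: "z = (i, j, k)" and U: "i \<in> U" "j \<in> U" "k \<in> U"
      and A: "A i j = 1" "A j k = 1" "A i k \<noteq> 1"
      by (auto simp: cherries_def)
    show "z \<in> (?T1 \<union> ?T2 \<union> ?T3) \<union> (?h1 ` ?M \<union> ?h2 ` ?M \<union> ?h3 ` ?M)"
    proof (rule ccontr)
      assume nz: "z \<notin> (?T1 \<union> ?T2 \<union> ?T3) \<union> (?h1 ` ?M \<union> ?h2 ` ?M \<union> ?h3 ` ?M)"
      have "i \<notin> Y" "j \<notin> Y" "k \<notin> Y" using nz U by (auto simp: z)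
      then have V: "i \<in> V" "j \<in> V" "k \<in> V"
        and big: "t \<le> real (card (cell (c i)))" "t \<le> real (card (cell (c j)))" "t \<le> real (card (cell (c k)))"
        using U by (auto simp: Y_def U_def V_def Small_def)
      have "(i, j) \<notin> M" "(j, k) \<notin> M" "(i, k) \<notin> M"
        using nz U by (force simp: z image_iff)+
      then have sq: "(A i j - d (c i) (c j))\<^sup>2 < (1 / 10)\<^sup>2" "(A j k - d (c j) (c k))\<^sup>2 < (1 / 10)\<^sup>2"
        "(A i k - d (c i) (c k))\<^sup>2 < (1 / 10)\<^sup>2"
        using V by (auto simp: M_def power2_eq_square)
      have A0: "A i k = 0" using A zero_one[of i k] U by (simp add: U_def)
      have small: "\<bar>y\<bar> < 1 / 10" if "y\<^sup>2 < (1 / 10)\<^sup>2" for y :: real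
        using power2_less_imp_less[of "\<bar>y\<bar>" "1 / 10"] that by simp
      have d1: "d (c i) (c j) > 9 / 10" using small[OF sq(1)] A(1) by linarith
      have d2: "d (c j) (c k) > 9 / 10" using small[OF sq(2)] A(2) by linarith
      have d3: "d (c i) (c k) < 1 / 10" using small[OF sq(3)] A0 by linarith
      define e where "e a = (if a = 0 then c i else if a = 1 then c j else c k)" for a :: nat
      have "d (e 0) (e 2) \<ge> 1 / 10"
      proof (rule no_cherry_of_blocks[where P = "\<lambda>a. cell (e a)" and d = "\<lambda>a b. d (e a) (e b)"
            and n = n and A = A and lam = lam and t = t, OF sym _ form lam _ _ gap d_eq])
        show "A i j \<le> 1" if "i < n" "j < n" for i j using zero_one[OF that] by auto
        show "cell (e a) \<subseteq> {..<n}" for a by (auto simp: cell_def V_def)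
        show "t \<le> real (card (cell (e a)))" for a using big by (simp add: e_def)
        show "d (e 0) (e 1) > 9 / 10" "d (e 1) (e 2) > 9 / 10" using d1 d2 by (simp_all add: e_def)
      qed
      then show False using d3 by (simp add: e_def)
    qed
  qed
  moreover have finM: "finite ?M" and finU: "finite U" and finY: "finite Y"
    using finite_subset[OF Msub] finite_subset[OF Ysub] finV by (auto simp: U_def)
  ultimately have "card ?C \<le> card ((?T1 \<union> ?T2 \<union> ?T3) \<union> (?h1 ` ?M \<union> ?h2 ` ?M \<union> ?h3 ` ?M))"
    by (intro card_mono) auto
  also have "\<dots> \<le> (card ?T1 + card ?T2 + card ?T3) + (card ?M + card ?M + card ?M)"
    by (intro order_trans[OF card_Un_le] add_mono card_image_le finM order_refl)
  finally have "real (card ?C) \<le> real ((card ?T1 + card ?T2 + card ?T3) + (card ?M + card ?M + card ?M))"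
    by (rule of_nat_mono)
  also have "\<dots> = 3 * real (card Y) * (real n)\<^sup>2 + 3 * real (card M) * real n"
    by (simp add: card_cartesian_product U_def power2_eq_square)
  also have "\<dots> \<le> 3 * (real (card X) + real (card L) * t) * (real n)\<^sup>2 + 3 * (100 * \<delta> * (real n)\<^sup>2) * real n"
    using cardY cardM by (intro add_mono mult_right_mono mult_left_mono) auto
  finally show ?thesis by (simp add: U_def power2_eq_square power3_eq_cube mult_ac)
qed

text \<open>Each vertex \<open>i\<close> is classified by its coordinates \<open>u k i\<close>
  rounded to a grid of width \<open>\<tau>\<close>, after discarding the set \<open>X\<close> of
  vertices with a coordinate above \<open>C\<close>. The number of classes depends on
  \<open>r\<close>, \<open>C\<close> and \<open>\<tau>\<close> but not on \<open>n\<close>.\<close>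

lemma few_cherries:
  assumes eps: "0 < \<epsilon>" "\<epsilon> < 1 / 4" and eta: "\<eta> > 0"
  shows "\<exists>n\<^sub>0. \<forall>n\<ge>n\<^sub>0. \<forall>A v l lam. zero_one_spectrum n A v l lam \<longrightarrow>
    lam \<le> real n powr (1 / 4 - \<epsilon>) \<longrightarrow>
    real (card (cherries (\<lambda>i j. A i j = 1) {..<n})) \<le> \<eta> * (real n) ^ 3"
proof -
  \<comment> \<open>The block error will be \<open>4 * \<delta>\<close>, and
    \<open>300 * 4 * \<delta>\<close> is half of \<open>\<eta>\<close>. The other half is shared
    equally between \<open>X\<close> and the small cells.\<close>
  define \<delta> where "\<delta> = \<eta> / 2400"
  have del: "\<delta> > 0" using eta by (simp add: \<delta>_def)
  from low_rank_approximation[OF eps del]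
  obtain r n\<^sub>1 where approx: "\<forall>n\<ge>n\<^sub>1. \<forall>A v l lam. zero_one_spectrum n A v l lam \<longrightarrow>
      lam \<le> real n powr (1 / 4 - \<epsilon>) \<longrightarrow>
      (\<exists>u. (\<forall>k<r. (\<Sum>i<n. (u k i)\<^sup>2) \<le> 4 * real n) \<and>
        (\<Sum>i<n. \<Sum>j<n. (A i j - (\<Sum>k<r::nat. u k i * u k j))\<^sup>2) \<le> \<delta> * (real n)\<^sup>2)"
    by (elim exE)
  \<comment> \<open>The squared coordinates total at most \<open>4 * r * n\<close>, so this
    \<open>C\<close> leaves at most \<open>\<eta> / 12 * n\<close> vertices in
    \<open>X\<close>.\<close>
  define C where "C = sqrt (48 * (real r + 1) / \<eta>)"
  have C: "C > 0" "C\<^sup>2 = 48 * (real r + 1) / \<eta>" using eta by (auto simp: C_def)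
  \<comment> \<open>Rounding costs at most \<open>\<tau> * (2 * C + 1)\<close> in each of the
    \<open>r\<close> products, hence at most \<open>sqrt \<delta>\<close> in total.\<close>
  define \<tau> where "\<tau> = min 1 (sqrt \<delta> / ((real r + 1) * (2 * C + 1)))"
  have tau: "0 < \<tau>" "\<tau> \<le> 1" using del C by (auto simp: \<tau>_def)
  have tau_r: "real r * (\<tau> * (2 * C + 1)) \<le> sqrt \<delta>"
  proof -
    have "\<tau> * ((real r + 1) * (2 * C + 1)) \<le> sqrt \<delta>"
      using C by (simp add: \<tau>_def flip: pos_le_divide_eq)
    moreover have "real r * (\<tau> * (2 * C + 1)) \<le> (real r + 1) * (\<tau> * (2 * C + 1))"
      using tau C by (intro mult_right_mono) auto
    ultimately show ?thesis by (simp add: mult_ac)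
  qed
  define L where "L = PiE {..<r} (\<lambda>_. {\<lfloor>- C / \<tau>\<rfloor>..\<lfloor>C / \<tau>\<rfloor>})"
  have finL: "finite L" by (simp add: L_def finite_PiE)
  \<comment> \<open>Cells below \<open>\<gamma> * n\<close> vertices are discarded; all of them
    together hold at most \<open>\<eta> / 12 * n\<close> vertices.\<close>
  define \<gamma> where "\<gamma> = \<eta> / (12 * (real (card L) + 1))"
  have gam: "\<gamma> > 0" using eta by (simp add: \<gamma>_def)
  have gam_L: "real (card L) * \<gamma> \<le> \<eta> / 12"
  proof -
    have "real (card L) * \<gamma> \<le> (real (card L) + 1) * \<gamma>" using gam by (intro mult_right_mono) auto
    also have "\<dots> = \<eta> / 12" by (simp add: \<gamma>_def field_simps)
    finally show ?thesis .
  qed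
  \<comment> \<open>Beyond this point \<open>45 * lam \<le> 45 * sqrt n < 2 * \<gamma> * n\<close>,
    the gap that the test vector needs.\<close>
  define n\<^sub>0 where "n\<^sub>0 = max n\<^sub>1 (nat \<lceil>(45 / (2 * \<gamma>))\<^sup>2\<rceil> + 1)"
  show ?thesis
  proof (rule exI[of _ n\<^sub>0], intro allI impI)
    fix n A v l lam
    assume nn: "n \<ge> n\<^sub>0" and z: "zero_one_spectrum n A v l lam" and le: "lam \<le> real n powr (1 / 4 - \<epsilon>)"
    interpret zero_one_spectrum n A v l lam by (rule z)
    have n: "n > 0" using nn by (simp add: n\<^sub>0_def)
    obtain u where u: "\<And>k. k < r \<Longrightarrow> (\<Sum>i<n. (u k i)\<^sup>2) \<le> 4 * real n"
      and err: "(\<Sum>i<n. \<Sum>j<n. (A i j - (\<Sum>k<r. u k i * u k j))\<^sup>2) \<le> \<delta> * (real n)\<^sup>2"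
      using approx[rule_format, OF _ z le] nn by (auto simp: n\<^sub>0_def)
    define X where "X = {i \<in> {..<n}. \<exists>k<r. \<bar>u k i\<bar> > C}"
    define c where "c i = restrict (\<lambda>k. \<lfloor>u k i / \<tau>\<rfloor>) {..<r}" for i
    define b where "b a a' = (\<Sum>k<r. (\<tau> * real_of_int (a k)) * (\<tau> * real_of_int (a' k)))" for a a' :: "nat \<Rightarrow> int"
    have small: "\<bar>u k i\<bar> \<le> C" if "i \<in> {..<n} - X" "k < r" for k i
      by (rule ccontr) (use that in \<open>auto simp: X_def\<close>)
    have "real (card X) * C\<^sup>2 = (\<Sum>i\<in>X. C\<^sup>2)" by simp
    also have "\<dots> \<le> (\<Sum>i\<in>X. \<Sum>k<r. (u k i)\<^sup>2)"
    proof (rule sum_mono)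
      fix i assume "i \<in> X"
      then obtain k where k: "k < r" "\<bar>u k i\<bar> > C" by (auto simp: X_def)
      have "C\<^sup>2 \<le> (u k i)\<^sup>2" using k C by (intro abs_le_square_iff[THEN iffD1]) auto
      also have "\<dots> \<le> (\<Sum>k<r. (u k i)\<^sup>2)" using k by (intro member_le_sum) auto
      finally show "C\<^sup>2 \<le> (\<Sum>k<r. (u k i)\<^sup>2)" .
    qed
    also have "\<dots> \<le> (\<Sum>i<n. \<Sum>k<r. (u k i)\<^sup>2)"
      by (intro sum_mono2) (auto simp: X_def sum_nonneg)
    also have "\<dots> = (\<Sum>k<r. \<Sum>i<n. (u k i)\<^sup>2)" by (rule sum.swap)
    also have "\<dots> \<le> (\<Sum>k<r. 4 * real n)" using u by (intro sum_mono) auto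
    also have "\<dots> \<le> (real r + 1) * (4 * real n)" by (simp add: algebra_simps)
    finally have "real (card X) * (48 * (real r + 1) / \<eta>) \<le> (real r + 1) * (4 * real n)" unfolding C(2) .
    then have "(real r + 1) * (real (card X) * 48) \<le> (real r + 1) * (4 * real n * \<eta>)"
      using eta by (simp add: field_simps)
    then have "real (card X) * 48 \<le> 4 * real n * \<eta>" by (simp add: mult_le_cancel_left)
    then have cardX: "real (card X) \<le> \<eta> / 12 * real n" by simp
    have cL: "c ` ({..<n} - X) \<subseteq> L"
    proof (rule image_subsetI)
      fix i assume i: "i \<in> {..<n} - X"
      show "c i \<in> L" unfolding c_def L_def
      proof (rule restrict_PiE_iff[THEN iffD2], intro ballI)
        fix k assume "k \<in> {..<r}"
        then have "- C \<le> u k i" "u k i \<le> C" using small[OF i, of k] by auto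
        then have "- C / \<tau> \<le> u k i / \<tau>" "u k i / \<tau> \<le> C / \<tau>"
          using tau by (simp_all only: divide_right_mono less_imp_le)
        then show "\<lfloor>u k i / \<tau>\<rfloor> \<in> {\<lfloor>- C / \<tau>\<rfloor>..\<lfloor>C / \<tau>\<rfloor>}" by (auto intro: floor_mono)
      qed
    qed
    have round: "\<bar>(\<Sum>k<r. u k i * u k j) - b (c i) (c j)\<bar> \<le> sqrt \<delta>"
      if i: "i \<in> {..<n} - X" and j: "j \<in> {..<n} - X" for i j
    proof -
      have "\<bar>(\<Sum>k<r. u k i * u k j) - b (c i) (c j)\<bar>
          = \<bar>\<Sum>k<r. u k i * u k j - (\<tau> * real_of_int \<lfloor>u k i / \<tau>\<rfloor>) * (\<tau> * real_of_int \<lfloor>u k j / \<tau>\<rfloor>)\<bar>"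
        by (simp add: b_def c_def sum_subtractf)
      also have "\<dots> \<le> (\<Sum>k<r. \<bar>u k i * u k j - (\<tau> * real_of_int \<lfloor>u k i / \<tau>\<rfloor>) * (\<tau> * real_of_int \<lfloor>u k j / \<tau>\<rfloor>)\<bar>)"
        by (rule sum_abs)
      also have "\<dots> \<le> (\<Sum>k<r. \<tau> * (2 * C + 1))"
      proof (rule sum_mono)
        fix k assume "k \<in> {..<r}"
        then have s: "\<bar>u k i\<bar> \<le> C" "\<bar>u k j\<bar> \<le> C" using small i j by auto
        have fl: "\<bar>x - \<tau> * real_of_int \<lfloor>x / \<tau>\<rfloor>\<bar> \<le> \<tau>" for x
        proof -
          have "real_of_int \<lfloor>x / \<tau>\<rfloor> * \<tau> \<le> x" "x < (real_of_int \<lfloor>x / \<tau>\<rfloor> + 1) * \<tau>"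
            using tau by (intro floor_divide_lower floor_divide_upper; simp)+
          then show ?thesis by (simp add: algebra_simps)
        qed
        let ?x = "u k i" and ?y = "u k j"
        let ?x' = "\<tau> * real_of_int \<lfloor>u k i / \<tau>\<rfloor>" and ?y' = "\<tau> * real_of_int \<lfloor>u k j / \<tau>\<rfloor>"
        have y': "\<bar>?y'\<bar> \<le> C + 1" using fl[of ?y] s tau by linarith
        have "\<bar>?x * ?y - ?x' * ?y'\<bar> = \<bar>?x * (?y - ?y') + (?x - ?x') * ?y'\<bar>" by (simp add: algebra_simps)
        also have "\<dots> \<le> \<bar>?x\<bar> * \<bar>?y - ?y'\<bar> + \<bar>?x - ?x'\<bar> * \<bar>?y'\<bar>"
          by (metis abs_mult abs_triangle_ineq)
        also have "\<dots> \<le> C * \<tau> + \<tau> * (C + 1)"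
          using s fl y' tau C by (intro add_mono mult_mono) auto
        also have "\<dots> = \<tau> * (2 * C + 1)" by (simp add: algebra_simps)
        finally show "\<bar>?x * ?y - ?x' * ?y'\<bar> \<le> \<tau> * (2 * C + 1)" .
      qed
      also have "\<dots> \<le> sqrt \<delta>" using tau_r by simp
      finally show ?thesis .
    qed
    let ?V = "{..<n} - X"
    have "(\<Sum>i\<in>?V. \<Sum>j\<in>?V. (A i j - b (c i) (c j))\<^sup>2)
        \<le> (\<Sum>i\<in>?V. \<Sum>j\<in>?V. 2 * (A i j - (\<Sum>k<r. u k i * u k j))\<^sup>2 + 2 * \<delta>)"
    proof (intro sum_mono)
      fix i j assume "i \<in> ?V" "j \<in> ?V"
      define s where "s = A i j - (\<Sum>k<r. u k i * u k j)"
      define t where "t = (\<Sum>k<r. u k i * u k j) - b (c i) (c j)"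
      have "\<bar>t\<bar> \<le> sqrt \<delta>" unfolding t_def using round \<open>i \<in> ?V\<close> \<open>j \<in> ?V\<close> by blast
      then have "t\<^sup>2 \<le> \<delta>" using del by (metis power2_abs real_le_rsqrt real_sqrt_abs real_sqrt_le_iff)
      moreover have "(s + t)\<^sup>2 \<le> 2 * s\<^sup>2 + 2 * t\<^sup>2"
        using zero_le_power2[of "s - t"] by (simp add: power2_eq_square algebra_simps)
      moreover have "A i j - b (c i) (c j) = s + t" by (simp add: s_def t_def)
      ultimately show "(A i j - b (c i) (c j))\<^sup>2 \<le> 2 * (A i j - (\<Sum>k<r. u k i * u k j))\<^sup>2 + 2 * \<delta>"
        unfolding s_def[symmetric] by simp
    qed
    also have "\<dots> \<le> (\<Sum>i<n. \<Sum>j\<in>?V. 2 * (A i j - (\<Sum>k<r. u k i * u k j))\<^sup>2 + 2 * \<delta>)"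
      using del by (intro sum_mono2 sum_nonneg) auto
    also have "\<dots> \<le> (\<Sum>i<n. \<Sum>j<n. 2 * (A i j - (\<Sum>k<r. u k i * u k j))\<^sup>2 + 2 * \<delta>)"
      using del by (intro sum_mono sum_mono2) auto
    also have "\<dots> = 2 * (\<Sum>i<n. \<Sum>j<n. (A i j - (\<Sum>k<r. u k i * u k j))\<^sup>2) + 2 * \<delta> * (real n)\<^sup>2"
      by (simp add: sum.distrib power2_eq_square flip: sum_distrib_left)
    also have "\<dots> \<le> 2 * (\<delta> * (real n)\<^sup>2) + 2 * \<delta> * (real n)\<^sup>2" using err by simp
    finally have err': "(\<Sum>i\<in>?V. \<Sum>j\<in>?V. (A i j - b (c i) (c j))\<^sup>2) \<le> (4 * \<delta>) * (real n)\<^sup>2" by simp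
    have gap: "45 * lam < 2 * (\<gamma> * real n)"
    proof -
      have "lam \<le> real n powr (1 / 2)"
        using le n eps by (elim order_trans) (intro powr_mono, auto)
      then have lam_le: "lam \<le> sqrt (real n)" by (simp add: powr_half_sqrt)
      have "(45 / (2 * \<gamma>))\<^sup>2 < real n" using nn unfolding n\<^sub>0_def by linarith
      then have "45 / (2 * \<gamma>) < sqrt (real n)" by (rule real_less_rsqrt)
      then have "45 < 2 * \<gamma> * sqrt (real n)" using gam by (simp add: field_simps)
      then have "45 * sqrt (real n) < (2 * \<gamma> * sqrt (real n)) * sqrt (real n)"
        using n by (intro mult_strict_right_mono) auto
      also have "\<dots> = 2 * (\<gamma> * real n)" by (simp add: mult.assoc)
      finally show ?thesis using lam_le by linarith
    qed
    have sym: "A i j = A j i" if "i < n" "j < n" for i j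
      using that by (simp add: expansion mult_ac)
    have "real (card (cherries (\<lambda>i j. A i j = 1) {..<n}))
      \<le> 3 * (real (card X) + real (card L) * (\<gamma> * real n)) * (real n)\<^sup>2 + 300 * (4 * \<delta>) * (real n) ^ 3"
      by (rule cherries_le_of_blocks[where c = c and b = b, OF zero_one sym quadratic_form_lower
            lam_nonneg _ finL cL err' gap]) (auto simp: X_def)
    also have "\<dots> \<le> 3 * (\<eta> / 12 * real n + \<eta> / 12 * real n) * (real n)\<^sup>2 + 300 * (4 * \<delta>) * (real n) ^ 3"
      using cardX mult_right_mono[OF gam_L, of "real n"]
      by (intro add_mono mult_right_mono mult_left_mono order_refl) (auto simp: mult.assoc)
    also have "\<dots> = \<eta> * (real n) ^ 3"
      by (simp add: \<delta>_def power2_eq_square power3_eq_cube algebra_simps)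
    finally show "real (card (cherries (\<lambda>i j. A i j = 1) {..<n})) \<le> \<eta> * (real n) ^ 3" .
  qed
qed

section \<open>From few cherries to disjoint cliques\<close>

text \<open>\<open>f\<close> assigns cluster labels. Pairs are ordered, so for symmetric
  \<open>adj\<close> each misclassified pair counts twice.\<close>

definition disagreements :: "('a \<Rightarrow> 'a \<Rightarrow> bool) \<Rightarrow> ('a \<Rightarrow> 'b) \<Rightarrow> 'a set \<Rightarrow> ('a \<times> 'a) set" where
  "disagreements adj f U = {(i, j). i \<in> U \<and> j \<in> U \<and> i \<noteq> j \<and> adj i j \<noteq> (f i = f j)}"

lemma finite_disagreements: "finite U \<Longrightarrow> finite (disagreements adj f U)"
  by (rule finite_subset[of _ "U \<times> U"]) (auto simp: disagreements_def)

lemma finite_cherries: "finite U \<Longrightarrow> finite (cherries adj U)"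
  by (rule finite_subset[of _ "U \<times> U \<times> U"]) (auto simp: cherries_def)

lemma sum_card_fibres:
  assumes "finite S" "finite U" "h ` S \<subseteq> U"
  shows "(\<Sum>v\<in>U. card {z \<in> S. h z = v}) = card S"
  using sum.group[OF assms, of "\<lambda>_. 1::nat"] by simp

text \<open>Greedy pivoting: a pair that is misclassified by declaring the closed neighbourhood of \<open>v\<close> to
  be a cluster spans an induced cherry through \<open>v\<close>, so averaging with weights \<open>deg v\<close> yields a
  pivot whose cost is proportional to the size of its cluster.\<close>

lemma cluster_of_few_cherries:
  fixes adj :: "'a \<Rightarrow> 'a \<Rightarrow> bool"
  assumes sym: "\<And>i j. adj i j \<Longrightarrow> adj j i" and irrefl: "\<And>i. \<not> adj i i"
    and T: "0 \<le> T" and D: "0 < D"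
    and "finite U" "real (card (cherries adj U)) \<le> T"
  shows "\<exists>f. f ` U \<subseteq> U \<and> real (card (disagreements adj f U)) \<le> D + 3 * T / D * real (card U)"
  using assms(5,6)
proof (induction "card U" arbitrary: U rule: less_induct)
  case less
  define N where "N v = {w \<in> U. adj v w}" for v
  define deg where "deg v = real (card (N v))" for v
  have finN: "finite (N v)" for v using less.prems by (simp add: N_def)
  show ?case
  proof (cases "(\<Sum>v\<in>U. deg v) \<le> D")
    \<comment> \<open>With few edges left, singleton clusters suffice: every remaining edge is a
      disagreement, and there are at most \<open>D\<close> of them as ordered pairs.\<close>
    case True
    have "disagreements adj id U = Sigma U N"
      using irrefl by (auto simp: disagreements_def N_def)
    then have "real (card (disagreements adj id U)) = (\<Sum>v\<in>U. deg v)"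
      using less.prems finN by (simp add: deg_def card_SigmaI)
    also have "\<dots> \<le> D + 3 * T / D * real (card U)" using True T D by (simp add: add_increasing2)
    finally show ?thesis by (intro exI[of _ id]) simp
  next
    case False
    let ?C = "cherries adj U"
    define mid where "mid v = {z \<in> ?C. fst (snd z) = v}" for v
    define fin where "fin v = {z \<in> ?C. fst z = v}" for v
    have finC: "finite ?C" using finite_cherries less.prems by blast
    \<comment> \<open>Cherries centred at \<open>v\<close> pay for non-adjacent pairs inside the
      cluster, cherries starting at \<open>v\<close> for edges leaving it. The factor 2 covers both
      orientations of a leaving edge; a non-adjacent pair already yields two triples.\<close>
    define cost where "cost v = real (card (mid v) + 2 * card (fin v))" for v
    have "(\<Sum>v\<in>U. card (mid v)) = card ?C" "(\<Sum>v\<in>U. card (fin v)) = card ?C"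
      unfolding mid_def fin_def by (intro sum_card_fibres finC less.prems; auto simp: cherries_def)+
    then have "(\<Sum>v\<in>U. card (mid v) + 2 * card (fin v)) = 3 * card ?C"
      by (simp add: sum.distrib flip: sum_distrib_left)
    then have "(\<Sum>v\<in>U. cost v) = real (3 * card ?C)"
      unfolding cost_def of_nat_sum[symmetric] by (simp only:)
    then have costs: "(\<Sum>v\<in>U. cost v) \<le> 3 * T" using less.prems by simp
    obtain v where v: "v \<in> U" "cost v \<le> 3 * T / D * deg v"
    proof (rule ccontr)
      assume "\<not> thesis"
      with that have "\<And>v. v \<in> U \<Longrightarrow> 3 * T / D * deg v < cost v" by force
      moreover have "U \<noteq> {}" using False D by auto
      ultimately have "(\<Sum>v\<in>U. 3 * T / D * deg v) < (\<Sum>v\<in>U. cost v)"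
        using less.prems by (intro sum_strict_mono) auto
      then have "3 * T / D * (\<Sum>v\<in>U. deg v) < 3 * T" 
        using costs unfolding sum_distrib_left by (rule order.strict_trans2)
      moreover have "3 * T / D * D \<le> 3 * T / D * (\<Sum>v\<in>U. deg v)"
        using False T D by (intro mult_left_mono) auto
      ultimately show False using D by simp
    qed
    define K where "K = insert v (N v)"
    define U' where "U' = U - K"
    have K: "K \<subseteq> U" "finite K" "v \<in> K" using v finN by (auto simp: K_def N_def)
    have cardK: "card K = card (N v) + 1" using finN irrefl by (simp add: K_def N_def)
    have cardU: "card U = card U' + card K"
      using K less.prems by (simp add: U'_def card_Diff_subset card_mono)
    have "cherries adj U' \<subseteq> ?C" by (auto simp: cherries_def U'_def)
    then have "real (card (cherries adj U')) \<le> T"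
      using card_mono[OF finC] less.prems by (meson of_nat_le_iff order_trans)
    moreover have "card U' < card U" using cardU cardK by simp
    moreover have "finite U'" using less.prems by (simp add: U'_def)
    ultimately obtain f' where f': "f' ` U' \<subseteq> U'"
      "real (card (disagreements adj f' U')) \<le> D + 3 * T / D * real (card U')"
      using less.hyps by blast
    \<comment> \<open>The pivot labels its own cluster. As \<open>f'\<close> maps \<open>U'\<close>
      into itself and \<open>v\<close> is outside \<open>U'\<close>, the new label is fresh; this is
      why the induction carries \<open>f\<close> with values in the vertex set.\<close>
    define f where "f i = (if i \<in> K then v else f' i)" for i
    have fU: "f ` U \<subseteq> U" using f'(1) v by (auto simp: f_def U'_def)
    let ?h1 = "\<lambda>(i, j, k). (i, k)" and ?h2 = "\<lambda>(i, j, k). (j, k)" and ?h3 = "\<lambda>(i, j, k). (k, j)"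
    have "disagreements adj f U \<subseteq> disagreements adj f' U' \<union> (?h1 ` mid v \<union> (?h2 ` fin v \<union> ?h3 ` fin v))"
    proof (rule subsetI)
      fix z assume "z \<in> disagreements adj f U"
      then obtain i j where z: "z = (i, j)" and ij: "i \<in> U" "j \<in> U" "i \<noteq> j" "adj i j \<noteq> (f i = f j)"
        by (auto simp: disagreements_def)
      have fK: "f k = v \<longleftrightarrow> k \<in> K" if "k \<in> U" for k
        using f'(1) that K by (auto simp: f_def U'_def)
      consider (both) "i \<in> K" "j \<in> K" | (left) "i \<in> K" "j \<notin> K" | (right) "i \<notin> K" "j \<in> K" | (none) "i \<notin> K" "j \<notin> K"
        by blast
      then show "z \<in> disagreements adj f' U' \<union> (?h1 ` mid v \<union> (?h2 ` fin v \<union> ?h3 ` fin v))"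
      proof cases
        case both
        then have n: "\<not> adj i j" using ij by (simp add: f_def)
        then have "adj v i" "adj v j" using both ij sym by (auto simp: K_def N_def)
        then have "(i, v, j) \<in> mid v" using n ij v sym by (auto simp: mid_def cherries_def)
        then have "z \<in> ?h1 ` mid v" unfolding z by force
        then show ?thesis by blast
      next
        case left
        then have n: "adj i j" using ij fK by (metis f_def)
        have "j \<noteq> v" "\<not> adj v j" using left ij by (auto simp: K_def N_def)
        moreover from this n left have "adj v i" by (auto simp: K_def N_def)
        ultimately have "(v, i, j) \<in> fin v" using n ij v by (auto simp: fin_def cherries_def)
        then have "z \<in> ?h2 ` fin v" unfolding z by force
        then show ?thesis by blast
      next
        case right
        then have n: "adj i j" using ij fK by (metis f_def)
        then have n': "adj j i" by (rule sym)
        have "i \<noteq> v" "\<not> adj v i" using right ij by (auto simp: K_def N_def)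
        moreover from this n' right have "adj v j" by (auto simp: K_def N_def)
        ultimately have "(v, j, i) \<in> fin v" using n' ij v by (auto simp: fin_def cherries_def)
        then have "z \<in> ?h3 ` fin v" unfolding z by force
        then show ?thesis by blast
      next
        case none
        then have "z \<in> disagreements adj f' U'" using ij by (simp add: z disagreements_def U'_def f_def)
        then show ?thesis by blast
      qed
    qed
    moreover have fins: "finite (mid v)" "finite (fin v)" using finC by (auto simp: mid_def fin_def)
    moreover have "finite (disagreements adj f' U')" using \<open>finite U'\<close> by (rule finite_disagreements)
    ultimately have "card (disagreements adj f U)
        \<le> card (disagreements adj f' U' \<union> (?h1 ` mid v \<union> (?h2 ` fin v \<union> ?h3 ` fin v)))"
      by (intro card_mono) auto
    also have "\<dots> \<le> card (disagreements adj f' U') + (card (mid v) + (card (fin v) + card (fin v)))"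
      by (intro order_trans[OF card_Un_le] add_mono card_image_le fins order_refl)
    finally have "real (card (disagreements adj f U))
        \<le> real (card (disagreements adj f' U') + (card (mid v) + (card (fin v) + card (fin v))))"
      by (rule of_nat_mono)
    also have "\<dots> = real (card (disagreements adj f' U')) + cost v" by (simp add: cost_def)
    also have "\<dots> \<le> (D + 3 * T / D * real (card U')) + 3 * T / D * real (card K)"
    proof -
      have "3 * T / D * deg v \<le> 3 * T / D * real (card K)"
        using T D by (intro mult_left_mono) (auto simp: deg_def cardK)
      then show ?thesis using f'(2) v(2) by linarith
    qed
    also have "\<dots> = D + 3 * T / D * real (card U)" by (simp add: cardU distrib_left)
    finally show ?thesis using fU by blast
  qed
qed

section \<open>Graphs of clusterings and their edit distance\<close>

definition cluster_graph :: "nat \<Rightarrow> (nat \<Rightarrow> 'b) \<Rightarrow> nat set set" where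
  "cluster_graph n f = {{i, j} | i j. i < n \<and> j < n \<and> i \<noteq> j \<and> f i = f j}"

lemma mem_cluster_graph: "{i, j} \<in> cluster_graph n f \<longleftrightarrow> i < n \<and> j < n \<and> i \<noteq> j \<and> f i = f j"
  by (auto simp: cluster_graph_def doubleton_eq_iff)

text \<open>The label is constant along edges, hence on connected components, and distinct vertices
  with equal labels are adjacent.\<close>

lemma disjoint_union_of_cliques_cluster_graph: "disjoint_union_of_cliques n (cluster_graph n f)"
  unfolding disjoint_union_of_cliques_def
proof (intro conjI ballI impI)
  show "simple_graph n (cluster_graph n f)"
    by (auto simp: simple_graph_def cluster_graph_def card_2_iff)
  have trans: "f u = f w" if "(u, w) \<in> {(u, w). {u, w} \<in> cluster_graph n f}\<^sup>*" for u w
    using that by (induction rule: rtrancl_induct) (auto simp: mem_cluster_graph)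
  fix C u w
  assume "C \<in> connected_components n (cluster_graph n f)" "u \<in> C" "w \<in> C" "u \<noteq> w"
  then obtain x where "(x, u) \<in> {(u, w). {u, w} \<in> cluster_graph n f}\<^sup>*" "u < n"
    "(x, w) \<in> {(u, w). {u, w} \<in> cluster_graph n f}\<^sup>*" "w < n"
    unfolding connected_components_def quotient_def by auto
  then show "{u, w} \<in> cluster_graph n f"
    using trans \<open>u \<noteq> w\<close> by (metis mem_cluster_graph)
qed

text \<open>Every differing edge is the underlying set of some ordered disagreement; counting
  ordered pairs only loses a factor.\<close>

lemma card_sym_diff_cluster_graph_le:
  assumes "simple_graph n G"
  shows "card (sym_diff G (cluster_graph n f)) \<le> card (disagreements (\<lambda>i j. {i, j} \<in> G) f {..<n})"
proof -
  have "sym_diff G (cluster_graph n f) \<subseteq> (\<lambda>(i, j). {i, j}) ` disagreements (\<lambda>i j. {i, j} \<in> G) f {..<n}"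
  proof
    fix e assume e: "e \<in> sym_diff G (cluster_graph n f)"
    obtain i j where ij: "e = {i, j}" "i < n" "j < n" "i \<noteq> j"
    proof (cases "e \<in> G")
      case True
      then have "e \<subseteq> {0..<n}" "card e = 2" using assms by (auto simp: simple_graph_def)
      then obtain i j where "e = {i, j}" "i \<noteq> j" by (meson card_2_iff)
      then show thesis using that \<open>e \<subseteq> {0..<n}\<close> by auto
    next
      case False
      then show thesis using e that by (auto simp: cluster_graph_def)
    qed
    then have "(i, j) \<in> disagreements (\<lambda>i j. {i, j} \<in> G) f {..<n}"
      using e by (auto simp: disagreements_def mem_cluster_graph)
    then show "e \<in> (\<lambda>(i, j). {i, j}) ` disagreements (\<lambda>i j. {i, j} \<in> G) f {..<n}"
      using ij(1) by force
  qed
  then show ?thesis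
    using surj_card_le finite_disagreements by (metis finite_lessThan)
qed

text \<open>Bridge from matrices to coordinates: each \<open>l k\<close> has the nonzero eigenvector
  \<open>v k\<close>, so it lies in the finite spectrum and is at least its minimum. The maximum
  with 0 supplies the sign condition of the locale.\<close>

lemma adjacency_spectrum:
  assumes G: "simple_graph n G"
  shows "\<exists>v l. zero_one_spectrum n (\<lambda>i j. if {i, j} \<in> G then 1 else 0) v l (max 0 (- least_eigenvalue n G))"
proof -
  define A :: "nat \<Rightarrow> nat \<Rightarrow> real" where "A i j = (if {i, j} \<in> G then 1 else 0)" for i j
  obtain v l where on: "orthonormal n n v"
    and eig: "\<And>a i. a < n \<Longrightarrow> i < n \<Longrightarrow> apply_mat n A (v a) i = l a * v a i"
    and dec: "\<And>a b. a \<le> b \<Longrightarrow> b < n \<Longrightarrow> l b \<le> l a"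
    by (rule symmetric_eigenbasis[of n A]) (auto simp: A_def insert_commute)
  let ?M = "adjacency_matrix n G"
  have M: "?M \<in> carrier_mat n n" by (simp add: adjacency_matrix_def)
  have lower: "- max 0 (- least_eigenvalue n G) \<le> l k" if k: "k < n" for k
  proof -
    have "eigenvector ?M (Matrix.vec n (v k)) (l k)"
      unfolding eigenvector_def
    proof (intro conjI)
      show "Matrix.vec n (v k) \<in> carrier_vec (dim_row ?M)" using M by simp
      show "Matrix.vec n (v k) \<noteq> 0\<^sub>v (dim_row ?M)"
      proof
        assume z: "Matrix.vec n (v k) = 0\<^sub>v (dim_row ?M)"
        have "v k i = 0" if "i < n" for i
          using arg_cong[OF z, of "\<lambda>w. vec_index w i"] that M by simp
        then have "dotn n (v k) (v k) = 0" by (simp add: dotn_def)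
        then show False using on k by (simp add: orthonormal_def)
      qed
      show "?M *\<^sub>v Matrix.vec n (v k) = l k \<cdot>\<^sub>v Matrix.vec n (v k)"
      proof (rule eq_vecI)
        show "dim_vec (?M *\<^sub>v Matrix.vec n (v k)) = dim_vec (l k \<cdot>\<^sub>v Matrix.vec n (v k))" using M by simp
        fix i assume "i < dim_vec (l k \<cdot>\<^sub>v Matrix.vec n (v k))"
        then have i: "i < n" by simp
        have "vec_index (?M *\<^sub>v Matrix.vec n (v k)) i = apply_mat n A (v k) i"
          using i by (simp add: adjacency_matrix_def scalar_prod_def apply_mat_def A_def atLeast0LessThan)
        then show "vec_index (?M *\<^sub>v Matrix.vec n (v k)) i = vec_index (l k \<cdot>\<^sub>v Matrix.vec n (v k)) i"
          using i eig[OF k i] by simp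
      qed
    qed
    then have "l k \<in> spectrum ?M" unfolding spectrum_def eigenvalue_def by blast
    moreover have "finite (spectrum ?M)" using card_finite_spectrum(1)[OF M] .
    ultimately have "least_eigenvalue n G \<le> l k" unfolding least_eigenvalue_def by simp
    then show ?thesis by linarith
  qed
  have "zero_one_spectrum n A v l (max 0 (- least_eigenvalue n G))"
  proof
    show "A i j = (\<Sum>k<n. l k * v k i * v k j)" if "i < n" "j < n" for i j
      using on eig that by (rule spectral_expansion)
    show "A i j = 0 \<or> A i j = 1" for i j by (simp add: A_def)
    show "A i i = 0" for i using G by (auto simp: A_def simple_graph_def)
  qed (use on dec lower in auto)
  then show ?thesis unfolding A_def by blast
qed

lemma close_to_cliques:
  assumes eps: "0 < \<epsilon>" "\<epsilon> < 1 / 4"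
  shows "\<exists>n\<^sub>0. \<forall>n\<ge>n\<^sub>0. \<forall>G. simple_graph n G \<longrightarrow> - (real n powr (1 / 4 - \<epsilon>)) < least_eigenvalue n G \<longrightarrow>
    (\<exists>H. disjoint_union_of_cliques n H \<and> eps_close \<epsilon> n G H)"
proof -
  \<comment> \<open>With \<open>T = \<eta> * n ^ 3\<close> and
    \<open>D = \<epsilon> / 2 * n\<^sup>2\<close>, the term \<open>3 * T / D * n\<close> equals
    \<open>\<epsilon> / 2 * n\<^sup>2\<close>, so the two costs of clustering add up to
    \<open>\<epsilon> * n\<^sup>2\<close>.\<close>
  define \<eta> where "\<eta> = \<epsilon>\<^sup>2 / 12"
  have eta: "\<eta> > 0" using eps by (simp add: \<eta>_def)
  from few_cherries[OF eps eta]
  obtain n\<^sub>1 where few: "\<forall>n\<ge>n\<^sub>1. \<forall>A v l lam. zero_one_spectrum n A v l lam \<longrightarrow>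
    lam \<le> real n powr (1 / 4 - \<epsilon>) \<longrightarrow>
    real (card (cherries (\<lambda>i j. A i j = 1) {..<n})) \<le> \<eta> * (real n) ^ 3"
    by (elim exE)
  show ?thesis
  proof (rule exI[of _ "max n\<^sub>1 1"], intro allI impI)
    fix n G
    assume nn: "n \<ge> max n\<^sub>1 1" and G: "simple_graph n G"
      and le: "- (real n powr (1 / 4 - \<epsilon>)) < least_eigenvalue n G"
    have n: "n > 0" "n \<ge> n\<^sub>1" using nn by auto
    let ?adj = "\<lambda>i j. {i, j} \<in> G"
    obtain v l where z: "zero_one_spectrum n (\<lambda>i j. if {i, j} \<in> G then 1 else 0) v l (max 0 (- least_eigenvalue n G))"
      using adjacency_spectrum[OF G] by blast
    have "max 0 (- least_eigenvalue n G) \<le> real n powr (1 / 4 - \<epsilon>)" using le by simp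
    from few[rule_format, OF n(2) z this]
    have "real (card (cherries ?adj {..<n})) \<le> \<eta> * (real n) ^ 3"
      by (simp add: if_distrib[of "\<lambda>x. x = 1"] if_bool_eq_conj cong: if_cong)
    moreover have "\<not> ?adj i i" for i using G by (auto simp: simple_graph_def)
    moreover have "0 < \<epsilon> / 2 * (real n)\<^sup>2" "0 \<le> \<eta> * (real n) ^ 3" using eps eta n by auto
    ultimately obtain f :: "nat \<Rightarrow> nat" where
      "real (card (disagreements ?adj f {..<n}))
        \<le> \<epsilon> / 2 * (real n)\<^sup>2 + 3 * (\<eta> * (real n) ^ 3) / (\<epsilon> / 2 * (real n)\<^sup>2) * real (card {..<n})"
      using cluster_of_few_cherries[of ?adj "\<eta> * (real n) ^ 3" "\<epsilon> / 2 * (real n)\<^sup>2" "{..<n}"]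
      by (auto simp: insert_commute)
    also have "\<dots> = \<epsilon> * (real n)\<^sup>2"
      using eps n by (simp add: \<eta>_def field_simps power2_eq_square power3_eq_cube)
    finally have "real (card (sym_diff G (cluster_graph n f))) \<le> \<epsilon> * (real n)\<^sup>2"
      using card_sym_diff_cluster_graph_le[OF G, of f] by linarith
    moreover have "simple_graph n (cluster_graph n f)"
      using disjoint_union_of_cliques_cluster_graph by (auto simp: disjoint_union_of_cliques_def)
    moreover have "graph_isomorphic n (cluster_graph n f) (cluster_graph n f)"
      unfolding graph_isomorphic_def by (intro exI[of _ id]) auto
    ultimately have "eps_close \<epsilon> n G (cluster_graph n f)" unfolding eps_close_def by blast
    then show "\<exists>H. disjoint_union_of_cliques n H \<and> eps_close \<epsilon> n G H"
      using disjoint_union_of_cliques_cluster_graph by blast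
  qed
qed

lemma eps_close_mono: "eps_close \<epsilon> n G H \<Longrightarrow> \<epsilon> \<le> \<epsilon>' \<Longrightarrow> eps_close \<epsilon>' n G H"
  unfolding eps_close_def by (meson mult_right_mono order_trans zero_le_power2)

theorem theorem1p3:
  shows "\<forall>\<epsilon>::real. \<epsilon> > 0 \<longrightarrow> (\<exists>n\<^sub>0::nat. \<forall>n\<ge>n\<^sub>0. \<forall>G. simple_graph n G \<longrightarrow>
           (\<forall>H. disjoint_union_of_cliques n H \<longrightarrow> eps_far \<epsilon> n G H) \<longrightarrow>
           least_eigenvalue n G \<le> - (real n powr (1 / 4 - \<epsilon>)))"
proof (intro allI impI)
  fix \<epsilon> :: real assume eps: "\<epsilon> > 0"
  \<comment> \<open>The spectral argument works below 1/4. Passing to a smaller parameter is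
    harmless: \<open>\<epsilon>\<close>-far implies \<open>\<epsilon>'\<close>-far, and for
    \<open>n \<ge> 1\<close> the resulting eigenvalue bound is at least as strong.\<close>
  define \<epsilon>' where "\<epsilon>' = min \<epsilon> (1 / 8)"
  have eps': "0 < \<epsilon>'" "\<epsilon>' < 1 / 4" "\<epsilon>' \<le> \<epsilon>" using eps by (auto simp: \<epsilon>'_def)
  from close_to_cliques[OF eps'(1,2)]
  obtain n\<^sub>1 where close: "\<forall>n\<ge>n\<^sub>1. \<forall>G. simple_graph n G \<longrightarrow>
      - (real n powr (1 / 4 - \<epsilon>')) < least_eigenvalue n G \<longrightarrow>
      (\<exists>H. disjoint_union_of_cliques n H \<and> eps_close \<epsilon>' n G H)"
    by (elim exE)
  show "\<exists>n\<^sub>0::nat. \<forall>n\<ge>n\<^sub>0. \<forall>G. simple_graph n G \<longrightarrow>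
           (\<forall>H. disjoint_union_of_cliques n H \<longrightarrow> eps_far \<epsilon> n G H) \<longrightarrow>
           least_eigenvalue n G \<le> - (real n powr (1 / 4 - \<epsilon>))"
  proof (rule exI[of _ "max n\<^sub>1 1"], intro allI impI)
    fix n G
    assume n: "n \<ge> max n\<^sub>1 1" and G: "simple_graph n G"
      and far: "\<forall>H. disjoint_union_of_cliques n H \<longrightarrow> eps_far \<epsilon> n G H"
    have "least_eigenvalue n G \<le> - (real n powr (1 / 4 - \<epsilon>'))"
    proof (rule ccontr)
      assume "\<not> ?thesis"
      then obtain H where "disjoint_union_of_cliques n H" "eps_close \<epsilon>' n G H"
        using close n G by (auto simp: not_le)
      then show False using far eps_close_mono[OF _ eps'(3)] by blast
    qed
    also have "\<dots> \<le> - (real n powr (1 / 4 - \<epsilon>))"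
      using n eps'(3) by (simp add: powr_mono)
    finally show "least_eigenvalue n G \<le> - (real n powr (1 / 4 - \<epsilon>))" .
  qed
qed

end
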